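(* Let $M\subset\mathbb{C}^n$ be a hypersurface and let $p\in M$ be a $\mathcal{C}^1$-smooth point of $M$. Suppose that $M$ is Levi-flat near $p$, i.e. $M$ divides $\mathbb{C}^n$ near $p$ into two pseudoconvex domains $M^+$ and $M^-$, and suppose that $M^+$ is convex. Then $M$ near $p$ is linearly equivalent to the Cartesian product of a planar curve and $\mathbb{C}^{n-1}$; that is, there exist an open neighbourhood $V$ of $p$, an invertible complex-linear map $L:\mathbb{C}^n\to\mathbb{C}^n$ and a real curve $\gamma\subset\mathbb{C}$ such that $L(M\cap V)=(\gamma\times\mathbb{C}^{n-1})\cap L(V)$.
   Context: "Hypersurface" means real hypersurface (real codimension one). A point $p\in M$ is a $\mathcal{C}^1$-smooth point if, in some neighbourhood of $p$, $M$ is an embedded $\mathcal{C}^1$-smooth real hypersurface. The phrase "$M$ divides $\mathbb{C}^n$ near $p$ into two pseudoconvex domains $M^+$ and $M^-$" means that there is an open neighbourhood $U$ of $p$ such that $M\cap U$ is a relatively closed $\mathcal{C}^1$-smooth embedded real hypersurface of $U$, the set $U\setminus M$ is the disjoint union of two nonempty connected open sets $M^+$ and $M^-$, each of which is a pseudoconvex domain in $\mathbb{C}^n$, and $M\cap U=\partial M^+\cap U=\partial M^-\cap U$. Convexity of $M^+$ is ordinary (real) geometric convexity in $\mathbb{C}^n\cong\mathbb{R}^{2n}$, for such a choice of $U$. A "planar curve" is a one-dimensional $\mathcal{C}^1$-smooth embedded real submanifold of $\mathbb{C}$. *)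

theory Defs
  imports "HOL-Analysis.Analysis"
begin

text \<open>Embedded \<open>C\<^sup>1\<close> real hypersurfaces of a Euclidean space, by local \<open>C\<^sup>1\<close> defining functions
  with nowhere vanishing gradient. The set \<open>S\<close> need not be closed in the whole space.\<close>

definition C1_hypersurface :: "'a::euclidean_space set \<Rightarrow> bool" where
  "C1_hypersurface S \<longleftrightarrow>
     (\<forall>q\<in>S. \<exists>W \<rho> g. open W \<and> q \<in> W \<and>
        continuous_on W g \<and>
        (\<forall>x\<in>W. (\<rho> has_derivative (\<lambda>h. g x \<bullet> h)) (at x) \<and> g x \<noteq> (0::'a)) \<and>
        S \<inter> W = {x\<in>W. \<rho> x = (0::real)})"

definition C1_smooth_point :: "'a::euclidean_space set \<Rightarrow> 'a \<Rightarrow> bool" where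
  "C1_smooth_point M p \<longleftrightarrow> p \<in> M \<and> (\<exists>N. open N \<and> p \<in> N \<and> C1_hypersurface (M \<inter> N))"

text \<open>A one-dimensional submanifold of the plane has real codimension one.\<close>

definition planar_curve :: "complex set \<Rightarrow> bool" where
  "planar_curve \<gamma> \<longleftrightarrow> C1_hypersurface \<gamma>"

text \<open>Only continuous real-valued (pluri)subharmonic functions are needed, since pseudoconvexity
  is defined through continuous exhaustion functions. For them the circle integral in the
  sub-mean-value inequality always exists.\<close>

definition cont_subharmonic_on :: "complex set \<Rightarrow> (complex \<Rightarrow> real) \<Rightarrow> bool" where
  "cont_subharmonic_on S u \<longleftrightarrow>
     continuous_on S u \<and>
     (\<forall>a r. 0 < r \<and> cball a r \<subseteq> S \<longrightarrow>
        u a \<le> 1 / (2 * pi) * integral {0..2 * pi} (\<lambda>t. u (a + of_real r * cis t)))"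

definition cont_plurisubharmonic_on :: "(complex^'n) set \<Rightarrow> (complex^'n \<Rightarrow> real) \<Rightarrow> bool" where
  "cont_plurisubharmonic_on \<Omega> u \<longleftrightarrow>
     continuous_on \<Omega> u \<and>
     (\<forall>a b. cont_subharmonic_on {\<tau>. a + \<tau> *s b \<in> \<Omega>} (\<lambda>\<tau>. u (a + \<tau> *s b)))"

text \<open>Pseudoconvexity: existence of a continuous plurisubharmonic exhaustion function
  (Hormander, An Introduction to Complex Analysis in Several Variables, Section 2.6).\<close>

definition pseudoconvex_domain :: "(complex^'n) set \<Rightarrow> bool" where
  "pseudoconvex_domain \<Omega> \<longleftrightarrow>
     open \<Omega> \<and> connected \<Omega> \<and> \<Omega> \<noteq> {} \<and>
     (\<exists>u. cont_plurisubharmonic_on \<Omega> u \<and>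
        (\<forall>c. compact (closure {z\<in>\<Omega>. u z < c}) \<and> closure {z\<in>\<Omega>. u z < c} \<subseteq> \<Omega>))"

definition divides_near ::
    "(complex^'n) set \<Rightarrow> complex^'n \<Rightarrow> (complex^'n) set \<Rightarrow> (complex^'n) set \<Rightarrow> (complex^'n) set \<Rightarrow> bool" where
  "divides_near M p U Mplus Mminus \<longleftrightarrow>
     open U \<and> p \<in> U \<and>
     closedin (top_of_set U) (M \<inter> U) \<and> C1_hypersurface (M \<inter> U) \<and>
     U - M = Mplus \<union> Mminus \<and> Mplus \<inter> Mminus = {} \<and>
     pseudoconvex_domain Mplus \<and> pseudoconvex_domain Mminus \<and>
     M \<inter> U = frontier Mplus \<inter> U \<and> M \<inter> U = frontier Mminus \<inter> U"

text \<open>The product of \<open>\<gamma>\<close> and \<open>\<complex>\<^sup>n\<^sup>-\<^sup>1\<close> inside \<open>\<complex>\<^sup>n\<close>. The index type carries no order, so the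
  coordinate \<open>k\<close> that plays the role of the first one is a parameter; for a one-element index
  type this is \<open>\<gamma>\<close> itself.\<close>

definition curve_times_Cn1 :: "'n \<Rightarrow> complex set \<Rightarrow> (complex^'n) set" where
  "curve_times_Cn1 k \<gamma> = {z. z $ k \<in> \<gamma>}"

end

theory Submission
  imports Defs
begin

text \<open>Let \<open>K\<close> be the closure of \<open>Mplus\<close>. If a complex line through \<open>q \<in> M\<close>, contained in the supporting
  hyperplane of \<open>K\<close> at \<open>q\<close>, met \<open>K\<close> only in a half plane of the line bounded through \<open>q\<close>, then
  slightly bent discs \<open>q + \<zeta> v - \<epsilon> (\<zeta> + \<zeta>\<^sup>2 / 2) n\<close> would touch \<open>K\<close> from \<open>Mminus\<close> in interior points
  only, against the Kontinuitaetssatz for the pseudoconvex \<open>Mminus\<close>. By convexity \<open>M\<close> therefore contains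
  a ball of fixed radius \<open>R\<close> of the complex tangent hyperplane at each \<open>q\<close> near \<open>p\<close>. Since such a
  ball at \<open>q'\<close> lies on one side of the tangent hyperplane at \<open>q\<close>, the angle between the complex
  tangent hyperplanes at \<open>q\<close> and \<open>q'\<close> is at most the distance of \<open>q'\<close> to the real tangent
  hyperplane at \<open>q\<close>, divided by \<open>R\<close>. That distance is \<open>o(\<bar>q - q'\<bar>)\<close>, so the complex tangent hyperplane is
  locally constant, and \<open>M\<close> is a union of parallel pieces of complex hyperplanes.\<close>

section \<open>The Hermitian product\<close>

text \<open>Complex linear in the first argument, with the Euclidean \<open>\<bullet>\<close> as its
  real part. So \<open>herm v n = 0\<close> says that the whole complex line spanned by
  \<open>v\<close> is orthogonal to \<open>n\<close>, that is, \<open>v\<close> is complex tangent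
  to the real hyperplane with normal \<open>n\<close>.\<close>

definition herm :: "complex^'n \<Rightarrow> complex^'n \<Rightarrow> complex" where
  "herm x y = (\<Sum>i\<in>UNIV. x $ i * cnj (y $ i))"

lemma herm_add: "herm (x + x') y = herm x y + herm x' y"
  by (simp add: herm_def algebra_simps sum.distrib)

lemma herm_diff: "herm (x - x') y = herm x y - herm x' y"
  by (simp add: herm_def algebra_simps sum_subtractf)

lemma herm_scale: "herm (c *s x) y = c * herm x y"
  by (simp add: herm_def sum_distrib_left mult.assoc)

lemma herm_cnj: "cnj (herm x y) = herm y x"
  by (simp add: herm_def mult.commute)

lemma Re_herm: "Re (herm x y) = x \<bullet> y"
  by (simp add: herm_def inner_vec_def inner_complex_def)

lemma herm_self: "herm x x = of_real ((norm x)\<^sup>2)"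
proof -
  have "Im (herm x x) = 0"
    using arg_cong[OF herm_cnj[of x x], of Im] by simp
  then show ?thesis
    by (simp add: complex_eq_iff Re_herm power2_norm_eq_inner)
qed

lemma scaleC_inner: "(c *s x) \<bullet> y = Re (c * herm x y)"
  by (metis Re_herm herm_scale)

lemma norm_scaleC: "norm (c *s (x :: complex^'n)) = cmod c * norm x"
proof -
  have "(norm (c *s x))\<^sup>2 = (cmod c * norm x)\<^sup>2"
  proof -
    have "(norm (c *s x))\<^sup>2 = Re (c * cnj (herm (c *s x) x))"
      by (metis herm_cnj power2_norm_eq_inner scaleC_inner)
    also have "\<dots> = (cmod c * norm x)\<^sup>2"
      by (simp add: herm_scale herm_self power_mult_distrib cmod_power2 del: of_real_power)
         (simp add: algebra_simps power2_eq_square)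
    finally show ?thesis .
  qed
  then show ?thesis by simp
qed

lemma unimodular_rotation:
  obtains c :: complex where "cmod c = 1" "c * z = of_real (cmod z)"
proof (cases "z = 0")
  case True
  then show ?thesis using that[of 1] by simp
next
  case False
  have "cnj z * z = of_real (cmod z) * of_real (cmod z)"
    using complex_norm_square[of z] by (simp add: power2_eq_square mult.commute)
  then show ?thesis
    using that[of "cnj z / of_real (cmod z)"] False by (simp add: norm_divide)
qed

text \<open>A unit scalar rotates the product to its modulus, which leaves the real Cauchy-Schwarz
  inequality.\<close>

lemma norm_herm_le: "cmod (herm x y) \<le> norm x * norm y"
proof -
  obtain c where c: "cmod c = 1" "c * herm x y = of_real (cmod (herm x y))"
    by (rule unimodular_rotation)
  have "cmod (herm x y) = (c *s x) \<bullet> y"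
    by (simp add: scaleC_inner c)
  also have "\<dots> \<le> norm (c *s x) * norm y"
    by (rule norm_cauchy_schwarz)
  finally show ?thesis by (simp add: norm_scaleC c)
qed

lemma continuous_on_scaleC [continuous_intros]:
  fixes g :: "'a::topological_space \<Rightarrow> complex^'n"
  assumes "continuous_on S f" "continuous_on S g"
  shows "continuous_on S (\<lambda>x. f x *s g x)"
  unfolding vector_scalar_mult_def
  by (intro continuous_intros assms)

section \<open>Kontinuitaetssatz for quadratic discs\<close>

text \<open>The error terms in the mean value comparison below are first and second harmonics, so
  they vanish from the circle average.\<close>

lemma integral_trig_zero:
  "((\<lambda>t. A * cos t + B * sin t + C * cos (2 * t) + D * sin (2 * t)) has_integral 0) {0..2 * pi::real}"
proof -
  let ?F = "\<lambda>t. A * sin t - B * cos t + C * sin (2 * t) / 2 - D * cos (2 * t) / 2"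
  have "((\<lambda>t. A * cos t + B * sin t + C * cos (2 * t) + D * sin (2 * t)) has_integral
      (?F (2 * pi) - ?F 0)) {0..2 * pi::real}"
    by (rule fundamental_theorem_of_calculus)
       (auto intro!: derivative_eq_intros simp flip: has_real_derivative_iff_has_vector_derivative)
  moreover have "cos (2 * (2 * pi)) = 1" "sin (2 * (2 * pi)) = (0::real)"
    using cos_int_2pin[of 2] sin_int_2pin[of 2] by (simp_all add: mult.commute mult.left_commute)
  ultimately show ?thesis by simp
qed

text \<open>Subharmonicity along the lines \<open>\<tau> \<mapsto> a + \<tau> b\<close> is transferred to the disc \<open>f\<close> by doubling the
  variables: at a maximum of \<open>u (f \<zeta> + w) - \<kappa> \<bar>w\<bar>\<^sup>2 + \<epsilon> \<bar>\<zeta>\<bar>\<^sup>2\<close> one moves \<open>\<zeta>\<close> by \<open>\<tau>\<close> and \<open>f \<zeta> + w\<close>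
  along the tangent line of \<open>f\<close>, which changes \<open>w\<close> only by \<open>- \<tau>\<^sup>2 c\<close>.\<close>

lemma psh_max_principle_quadratic_disc:
  fixes a b c :: "complex^'n" and f :: "complex \<Rightarrow> complex^'n"
  defines "f \<equiv> \<lambda>\<zeta>. a + \<zeta> *s b + \<zeta>\<^sup>2 *s c"
  assumes psh: "cont_plurisubharmonic_on \<Omega> u" and "\<eta> > 0"
    and tube: "\<And>\<zeta> w. cmod \<zeta> \<le> 1 \<Longrightarrow> norm w \<le> \<eta> \<Longrightarrow> f \<zeta> + w \<in> \<Omega>"
    and bdry: "\<And>\<zeta> w. cmod \<zeta> = 1 \<Longrightarrow> norm w \<le> \<eta> \<Longrightarrow> u (f \<zeta> + w) \<le> C"
    and "cmod \<zeta>1 \<le> 1"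
  shows "u (f \<zeta>1) \<le> C"
proof (rule ccontr)
  assume "\<not> u (f \<zeta>1) \<le> C"
  define N :: "(complex \<times> (complex^'n)) set" where "N = cball 0 1 \<times> cball 0 \<eta>"
  have contf: "continuous_on S f" for S
    unfolding f_def by (intro continuous_intros)
  have cont_u: "continuous_on \<Omega> u"
    using psh by (simp add: cont_plurisubharmonic_on_def)
  have cont_uN: "continuous_on N (\<lambda>(\<zeta>, w). u (f \<zeta> + w))"
    unfolding case_prod_beta
    by (rule continuous_on_compose2[OF cont_u])
       (auto simp: N_def tube intro!: continuous_intros continuous_on_compose2[OF contf[of UNIV]])
  have "compact N" by (simp add: N_def compact_Times)
  then have "compact ((\<lambda>(\<zeta>, w). u (f \<zeta> + w)) ` N)"
    using cont_uN by (rule compact_continuous_image[rotated])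
  then obtain B where "\<And>y. y \<in> (\<lambda>(\<zeta>, w). u (f \<zeta> + w)) ` N \<Longrightarrow> norm y \<le> B"
    by (meson bounded_iff compact_imp_bounded)
  then have B: "u (f \<zeta> + w) \<le> B" if "cmod \<zeta> \<le> 1" "norm w \<le> \<eta>" for \<zeta> w
    using that by (force simp: N_def)
  \<comment> \<open>Half of the excess over \<open>C\<close>: even after adding
    \<open>\<epsilon>\<close>, the values over the unit circle stay below
    \<open>u (f \<zeta>1)\<close>, so the maximum is not attained there.\<close>
  define \<epsilon> where "\<epsilon> = (u (f \<zeta>1) - C) / 2"
  have "\<epsilon> > 0" and eps: "u (f \<zeta>1) > C + \<epsilon>"
    using \<open>\<not> u (f \<zeta>1) \<le> C\<close> by (auto simp: \<epsilon>_def field_simps)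
  \<comment> \<open>Large enough that the penalty outweighs the bound \<open>B\<close> at
    \<open>norm w = \<eta>\<close>, which keeps the maximum off that sphere too.\<close>
  define \<kappa> where "\<kappa> = (\<bar>B + \<epsilon> - u (f \<zeta>1)\<bar> + 1) / \<eta>\<^sup>2"
  have "\<kappa> > 0" and kap: "B - \<kappa> * \<eta>\<^sup>2 + \<epsilon> < u (f \<zeta>1)"
    using \<open>\<eta> > 0\<close> by (auto simp: \<kappa>_def intro!: divide_pos_pos)
  define \<Psi> where "\<Psi> = (\<lambda>(\<zeta>, w). u (f \<zeta> + w) - \<kappa> * (norm w)\<^sup>2 + \<epsilon> * (cmod \<zeta>)\<^sup>2)"
  have "continuous_on N \<Psi>"
    unfolding \<Psi>_def using cont_uN
    by (auto simp: case_prod_beta intro!: continuous_intros)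
  moreover have "N \<noteq> {}" using \<open>\<eta> > 0\<close> by (auto simp: N_def)
  ultimately obtain \<zeta>0 w0 where in_N: "(\<zeta>0, w0) \<in> N" and max0: "\<And>z. z \<in> N \<Longrightarrow> \<Psi> z \<le> \<Psi> (\<zeta>0, w0)"
    using continuous_attains_sup[OF \<open>compact N\<close>, of \<Psi>] by (metis surj_pair)
  have z0: "cmod \<zeta>0 \<le> 1" and w0: "norm w0 \<le> \<eta>" using in_N by (auto simp: N_def)
  have big: "u (f \<zeta>1) \<le> \<Psi> (\<zeta>0, w0)"
  proof -
    have "u (f \<zeta>1) \<le> \<Psi> (\<zeta>1, 0)"
      using \<open>\<epsilon> > 0\<close> by (simp add: \<Psi>_def)
    also have "\<dots> \<le> \<Psi> (\<zeta>0, w0)"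
      using max0[of "(\<zeta>1, 0)"] \<open>\<eta> > 0\<close> \<open>cmod \<zeta>1 \<le> 1\<close> by (auto simp: N_def)
    finally show ?thesis .
  qed
  have le1: "\<epsilon> * (cmod \<zeta>0)\<^sup>2 \<le> \<epsilon>"
    using z0 \<open>\<epsilon> > 0\<close> by (simp add: mult_left_le power_le_one)
  have "cmod \<zeta>0 \<noteq> 1"
  proof
    assume *: "cmod \<zeta>0 = 1"
    have "0 \<le> \<kappa> * (norm w0)\<^sup>2" using \<open>\<kappa> > 0\<close> by simp
    then show False using bdry[OF * w0] big eps * by (simp add: \<Psi>_def)
  qed
  then have z0': "cmod \<zeta>0 < 1" using z0 by simp
  have "norm w0 \<noteq> \<eta>"
    using B[OF z0 w0] big kap le1 by (auto simp: \<Psi>_def)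
  then have w0': "norm w0 < \<eta>" using w0 by simp
  define y0 where "y0 = f \<zeta>0 + w0"
  define b0 where "b0 = b + (2 * \<zeta>0) *s c"
  \<comment> \<open>The second entry keeps \<open>\<zeta>0 + \<tau>\<close> in the disc. The first
    gives \<bar>\<tau>\<bar> squared \<le> \<open>s\<close>, so that the third keeps
    \<open>w0 - \<tau>\<^sup>2 *s c\<close> in the \<eta>-ball. The last makes \<open>E\<close>
    below negative.\<close>
  define s where "s = Min {1, 1 - cmod \<zeta>0, (\<eta> - norm w0) / (norm c + 1), \<epsilon> / (2 * \<kappa> * ((norm c)\<^sup>2 + 1))}"
  have sn: "norm c + 1 > 0" "(norm c)\<^sup>2 + 1 > 0" by (auto simp: add_nonneg_pos)
  have "s > 0"
    unfolding s_def using z0' w0' \<open>\<epsilon> > 0\<close> \<open>\<kappa> > 0\<close> sn by simp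
  have s1: "s \<le> 1" and s2: "s \<le> 1 - cmod \<zeta>0" and s3: "s \<le> (\<eta> - norm w0) / (norm c + 1)"
    and s4: "s \<le> \<epsilon> / (2 * \<kappa> * ((norm c)\<^sup>2 + 1))"
    unfolding s_def by (intro Min_le; simp)+
  have s3': "s * norm c \<le> \<eta> - norm w0"
  proof -
    have "s * (norm c + 1) \<le> \<eta> - norm w0" using s3 sn by (simp add: field_simps)
    then show ?thesis using \<open>s > 0\<close> by (simp add: algebra_simps)
  qed
  have shift: "f (\<zeta>0 + \<tau>) + (w0 - \<tau>\<^sup>2 *s c) = y0 + \<tau> *s b0" for \<tau>
    unfolding f_def y0_def b0_def
    by (simp add: power2_sum vector_sadd_rdistrib vector_add_ldistrib algebra_simps power2_eq_square)
  have adm: "cmod (\<zeta>0 + \<tau>) \<le> 1 \<and> norm (w0 - \<tau>\<^sup>2 *s c) \<le> \<eta>" if "cmod \<tau> \<le> s" for \<tau>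
  proof
    show "cmod (\<zeta>0 + \<tau>) \<le> 1" using that s2 norm_triangle_ineq[of \<zeta>0 \<tau>] by linarith
    have "(cmod \<tau>)\<^sup>2 \<le> s"
      using that s1 \<open>s > 0\<close> by (smt (verit) mult_left_le norm_ge_zero power2_eq_square)
    then have "norm (\<tau>\<^sup>2 *s c) \<le> s * norm c"
      by (simp add: norm_scaleC norm_power mult_right_mono)
    then show "norm (w0 - \<tau>\<^sup>2 *s c) \<le> \<eta>"
      using s3' norm_triangle_ineq4[of w0 "\<tau>\<^sup>2 *s c"] by linarith
  qed
  have inOm: "y0 + \<tau> *s b0 \<in> \<Omega>" if "cmod \<tau> \<le> s" for \<tau>
    using tube[of "\<zeta>0 + \<tau>" "w0 - \<tau>\<^sup>2 *s c"] adm[OF that] by (simp add: shift)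
  \<comment> \<open>The part of the comparison on the circle of radius \<open>s\<close> that
    survives averaging: the cost of the shift of \<open>w\<close> is of order \<open>s ^ 4\<close>,
    the gain from \<zeta> is \<open>\<epsilon> * s\<^sup>2\<close>. The rest is \<open>trig\<close>,
    of mean zero.\<close>
  define E where "E = \<kappa> * s ^ 4 * (norm c)\<^sup>2 - \<epsilon> * s\<^sup>2"
  have "E < 0"
  proof -
    have "\<kappa> * s * (norm c)\<^sup>2 * 2 \<le> \<kappa> * s * ((norm c)\<^sup>2 + 1) * 2"
      using \<open>\<kappa> > 0\<close> \<open>s > 0\<close> by (simp add: mult_left_mono)
    also have "\<dots> \<le> \<epsilon>"
    proof -
      have "2 * \<kappa> * ((norm c)\<^sup>2 + 1) > 0" using \<open>\<kappa> > 0\<close> sn by simp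
      then show ?thesis using s4 by (simp add: pos_le_divide_eq algebra_simps)
    qed
    finally have "\<kappa> * s * (norm c)\<^sup>2 < \<epsilon>" using \<open>\<epsilon> > 0\<close> by linarith
    moreover have "\<kappa> * s\<^sup>2 * (norm c)\<^sup>2 \<le> \<kappa> * s * (norm c)\<^sup>2"
      using s1 \<open>s > 0\<close> \<open>\<kappa> > 0\<close> by (simp add: mult_left_mono mult_right_mono power2_eq_square)
    ultimately have "s\<^sup>2 * (\<kappa> * s\<^sup>2 * (norm c)\<^sup>2 - \<epsilon>) < 0"
      using \<open>s > 0\<close> by (simp add: mult_pos_neg)
    then show ?thesis by (simp add: E_def algebra_simps power4_eq_xxxx power2_eq_square)
  qed
  define h where "h = herm c w0"
  define trig where "trig t = (- 2 * \<epsilon> * s * Re \<zeta>0) * cos t + (- 2 * \<epsilon> * s * Im \<zeta>0) * sin t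
      + (- 2 * \<kappa> * s\<^sup>2 * Re h) * cos (2 * t) + (2 * \<kappa> * s\<^sup>2 * Im h) * sin (2 * t)" for t :: real
  have pointwise: "u (y0 + (of_real s * cis t) *s b0) \<le> u y0 + E + trig t" for t
  proof -
    define \<tau> where "\<tau> = of_real s * cis t"
    have ct: "cmod \<tau> = s" using \<open>s > 0\<close> by (simp add: \<tau>_def norm_mult)
    have sq: "\<tau>\<^sup>2 = of_real (s\<^sup>2) * cis (2 * t)"
      by (simp add: \<tau>_def power_mult_distrib Complex.DeMoivre)
    have n1: "(norm (w0 - \<tau>\<^sup>2 *s c))\<^sup>2 = (norm w0)\<^sup>2 - 2 * Re (\<tau>\<^sup>2 * h) + s ^ 4 * (norm c)\<^sup>2"
    proof -
      have "(norm (w0 - \<tau>\<^sup>2 *s c))\<^sup>2 = (norm w0)\<^sup>2 - 2 * ((\<tau>\<^sup>2 *s c) \<bullet> w0) + (norm (\<tau>\<^sup>2 *s c))\<^sup>2"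
        by (simp add: power2_norm_eq_inner inner_diff inner_commute algebra_simps)
      then show ?thesis
        by (simp add: h_def scaleC_inner norm_scaleC norm_power ct power_mult_distrib flip: power_mult)
    qed
    have n2: "(cmod (\<zeta>0 + \<tau>))\<^sup>2 = (cmod \<zeta>0)\<^sup>2 + 2 * (\<zeta>0 \<bullet> \<tau>) + s\<^sup>2"
      by (simp add: power2_norm_eq_inner inner_add inner_commute algebra_simps flip: ct)
    have "\<Psi> (\<zeta>0 + \<tau>, w0 - \<tau>\<^sup>2 *s c) \<le> \<Psi> (\<zeta>0, w0)"
      using adm[of \<tau>] ct by (intro max0) (auto simp: N_def)
    then have "u (y0 + \<tau> *s b0) - \<kappa> * ((norm w0)\<^sup>2 - 2 * Re (\<tau>\<^sup>2 * h) + s ^ 4 * (norm c)\<^sup>2)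
          + \<epsilon> * ((cmod \<zeta>0)\<^sup>2 + 2 * (\<zeta>0 \<bullet> \<tau>) + s\<^sup>2)
        \<le> u y0 - \<kappa> * (norm w0)\<^sup>2 + \<epsilon> * (cmod \<zeta>0)\<^sup>2"
      unfolding \<Psi>_def case_prod_conv shift n1 n2 y0_def by simp
    moreover have "- 2 * \<kappa> * Re (\<tau>\<^sup>2 * h) - 2 * \<epsilon> * (\<zeta>0 \<bullet> \<tau>) = trig t"
      unfolding sq unfolding \<tau>_def
      by (simp add: trig_def inner_complex_def algebra_simps)
    ultimately show ?thesis
      by (simp add: E_def \<tau>_def algebra_simps)
  qed
  have sub: "cont_subharmonic_on {\<tau>. y0 + \<tau> *s b0 \<in> \<Omega>} (\<lambda>\<tau>. u (y0 + \<tau> *s b0))"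
    using psh by (simp add: cont_plurisubharmonic_on_def)
  have "cball 0 s \<subseteq> {\<tau>. y0 + \<tau> *s b0 \<in> \<Omega>}" using inOm by auto
  then have mean: "u y0 \<le> 1 / (2 * pi) * integral {0..2 * pi} (\<lambda>t. u (y0 + (of_real s * cis t) *s b0))"
    using sub \<open>s > 0\<close> unfolding cont_subharmonic_on_def by fastforce
  have int1: "(\<lambda>t. u (y0 + (of_real s * cis t) *s b0)) integrable_on {0..2 * pi}"
    using inOm \<open>s > 0\<close>
    by (intro integrable_continuous_interval continuous_on_compose2[OF cont_u] continuous_intros)
       (auto simp: norm_mult)
  have int2: "((\<lambda>t. u y0 + E + trig t) has_integral (2 * pi * (u y0 + E) + 0)) {0..2 * pi}"
    unfolding trig_def
    by (intro has_integral_add integral_trig_zero) (use has_integral_const_real[of "u y0 + E" 0 "2 * pi"] in \<open>simp\<close>)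
  have "integral {0..2 * pi} (\<lambda>t. u (y0 + (of_real s * cis t) *s b0)) \<le> 2 * pi * (u y0 + E) + 0"
    using int1 int2 pointwise by (intro has_integral_le[OF integrable_integral]) auto
  then have "u y0 \<le> 1 / (2 * pi) * (2 * pi * (u y0 + E))"
    using mean by (smt (verit) pi_gt_zero mult_left_mono divide_nonneg_nonneg)
  then show False using \<open>E < 0\<close> by simp
qed

lemma compact_tube_subset_open:
  fixes S :: "'a::euclidean_space set"
  assumes "compact S" "open T" "S \<subseteq> T"
  obtains \<eta> where "\<eta> > 0" "\<And>x w. x \<in> S \<Longrightarrow> norm w \<le> \<eta> \<Longrightarrow> x + w \<in> T"
proof -
  obtain d where d: "d > 0" "\<And>x y. x \<in> S \<Longrightarrow> y \<in> - T \<Longrightarrow> d \<le> dist x y"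
    using separate_compact_closed[of S "- T"] assms
    by (metis Diff_eq Diff_eq_empty_iff closed_Compl)
  show ?thesis
  proof (rule that[of "d / 2"])
    fix x w :: 'a assume "x \<in> S" "norm w \<le> d / 2"
    then show "x + w \<in> T" using d(2)[of x "x + w"] d(1) by (force simp: dist_norm)
  qed (use d in simp)
qed

lemma divide_le_self:
  fixes x :: real
  assumes "0 \<le> x" "1 \<le> y"
  shows "x / y \<le> x"
  using assms mult_left_mono[of 1 y x] by (simp add: divide_le_eq)

text \<open>By the maximum principle, \<open>u\<close> is bounded on the shifted discs by its bound
  on a compact tube around the circle of the limit disc, uniformly in small \<open>t\<close>. The
  points \<open>f \<zeta>1 + t *\<^sub>R e\<close> therefore stay in one sublevel set of the
  exhaustion, whose closure lies in \<Omega>, and so does their limit.\<close>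

lemma kontinuitaetssatz_quadratic_disc:
  fixes a b c e :: "complex^'n" and f :: "complex \<Rightarrow> complex^'n"
  defines "f \<equiv> \<lambda>\<zeta>. a + \<zeta> *s b + \<zeta>\<^sup>2 *s c"
  assumes pc: "pseudoconvex_domain \<Omega>"
    and circle: "\<And>\<zeta>. cmod \<zeta> = 1 \<Longrightarrow> f \<zeta> \<in> \<Omega>"
    and disc: "\<And>\<zeta> t. cmod \<zeta> \<le> 1 \<Longrightarrow> 0 < t \<Longrightarrow> t \<le> 1 \<Longrightarrow> f \<zeta> + t *\<^sub>R e \<in> \<Omega>"
    and z1: "cmod \<zeta>1 \<le> 1"
  shows "f \<zeta>1 \<in> \<Omega>"
proof -
  obtain u where psh: "cont_plurisubharmonic_on \<Omega> u"
    and exh: "\<And>c. closure {z\<in>\<Omega>. u z < c} \<subseteq> \<Omega>" and "open \<Omega>"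
    using pc unfolding pseudoconvex_domain_def by blast
  have cont_u: "continuous_on \<Omega> u"
    using psh by (simp add: cont_plurisubharmonic_on_def)
  have contf: "continuous_on S f" for S
    unfolding f_def by (intro continuous_intros)
  have "compact (f ` sphere 0 1)"
    by (intro compact_continuous_image contf compact_sphere)
  then obtain \<eta> where \<eta>: "\<eta> > 0" "\<And>x w. x \<in> f ` sphere 0 1 \<Longrightarrow> norm w \<le> \<eta> \<Longrightarrow> x + w \<in> \<Omega>"
    using compact_tube_subset_open[OF _ \<open>open \<Omega>\<close>] circle by (metis (no_types, lifting) image_subsetI mem_sphere_0)
  define E where "E = (\<lambda>(\<zeta>, w). f \<zeta> + w) ` (sphere 0 1 \<times> cball 0 \<eta>)"
  have "compact E"
    unfolding E_def case_prod_beta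
    by (intro compact_continuous_image compact_Times compact_sphere compact_cball
        continuous_intros continuous_on_compose2[OF contf[of UNIV]]) auto
  have "E \<subseteq> \<Omega>" using \<eta>(2) by (force simp: E_def)
  have "compact (u ` E)"
    using continuous_on_subset[OF cont_u \<open>E \<subseteq> \<Omega>\<close>] \<open>compact E\<close> by (rule compact_continuous_image)
  then obtain C where "\<And>y. y \<in> u ` E \<Longrightarrow> norm y \<le> C"
    by (meson bounded_iff compact_imp_bounded)
  then have C: "u (f \<zeta> + w) \<le> C" if "cmod \<zeta> = 1" "norm w \<le> \<eta>" for \<zeta> w
    using that by (force simp: E_def)
  have bound: "u (f \<zeta>1 + t *\<^sub>R e) \<le> C" if t: "0 < t" "t \<le> 1" "t * norm e \<le> \<eta> / 2" for t
  proof -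
    define g where "g \<zeta> = (a + t *\<^sub>R e) + \<zeta> *s b + \<zeta>\<^sup>2 *s c" for \<zeta>
    have g: "g \<zeta> = f \<zeta> + t *\<^sub>R e" for \<zeta> by (simp add: g_def f_def)
    have "compact (g ` cball 0 1)"
      unfolding g by (intro compact_continuous_image contf continuous_intros compact_cball)
    moreover have "g ` cball 0 1 \<subseteq> \<Omega>" using disc t by (auto simp: g)
    ultimately obtain \<theta> where \<theta>: "\<theta> > 0" "\<And>x w. x \<in> g ` cball 0 1 \<Longrightarrow> norm w \<le> \<theta> \<Longrightarrow> x + w \<in> \<Omega>"
      using compact_tube_subset_open[OF _ \<open>open \<Omega>\<close>] by blast
    have "u (g \<zeta>1) \<le> C"
      unfolding g_def
    \<comment> \<open>\<theta> keeps the thickened disc in \<Omega>; \<open>\<eta> / 2\<close>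
      leaves the other half of \<eta> for the shift \<open>t *\<^sub>R e\<close>.\<close>
    proof (rule psh_max_principle_quadratic_disc[OF psh, where \<eta> = "min \<theta> (\<eta> / 2)"], fold g_def)
      show "0 < min \<theta> (\<eta> / 2)" using \<theta> \<eta> by simp
      show "g \<zeta> + w \<in> \<Omega>" if "cmod \<zeta> \<le> 1" "norm w \<le> min \<theta> (\<eta> / 2)" for \<zeta> w
        using that by (intro \<theta>(2)) auto
      show "u (g \<zeta> + w) \<le> C" if "cmod \<zeta> = 1" "norm w \<le> min \<theta> (\<eta> / 2)" for \<zeta> w
      proof -
        have "norm (t *\<^sub>R e + w) \<le> \<eta>"
          using norm_triangle_ineq[of "t *\<^sub>R e" w] that t by simp
        then show ?thesis using C[OF that(1)] by (simp add: g add.assoc)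
      qed
    qed (rule z1)
    then show ?thesis by (simp add: g)
  qed
  define t where "t n = min 1 (\<eta> / (2 * (norm e + 1))) / real (Suc n)" for n
  have pos: "norm e + 1 > 0" by (simp add: add_nonneg_pos)
  have t0: "0 < t n" "t n \<le> 1" "t n * norm e \<le> \<eta> / 2" for n
  proof -
    have m: "0 < min 1 (\<eta> / (2 * (norm e + 1)))" using \<eta> pos by simp
    then show "0 < t n" by (simp add: t_def)
    have le: "t n \<le> min 1 (\<eta> / (2 * (norm e + 1)))"
      unfolding t_def by (rule divide_le_self[OF less_imp_le[OF m]]) simp
    then show "t n \<le> 1" by simp
    have "t n * (norm e + 1) \<le> \<eta> / 2"
      using le pos by (simp add: field_simps)
    then show "t n * norm e \<le> \<eta> / 2" using \<open>0 < t n\<close> by (simp add: algebra_simps)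
  qed
  have "t \<longlonglongrightarrow> 0"
    unfolding t_def using LIMSEQ_Suc[OF lim_const_over_n[of "min 1 (\<eta> / (2 * (norm e + 1)))"]] by simp
  then have "(\<lambda>n. f \<zeta>1 + t n *\<^sub>R e) \<longlonglongrightarrow> f \<zeta>1 + 0 *\<^sub>R e"
    by (intro tendsto_intros)
  moreover have "f \<zeta>1 + t n *\<^sub>R e \<in> {z\<in>\<Omega>. u z < C + 1}" for n
    using disc[OF z1, of "t n"] bound[of "t n"] t0[of n] by auto
  ultimately have "f \<zeta>1 + 0 *\<^sub>R e \<in> closure {z\<in>\<Omega>. u z < C + 1}"
    by (metis (no_types, lifting) closure_sequential)
  then show ?thesis using exh by auto
qed

section \<open>Complex tangent balls\<close>

text \<open>With x = Re \<zeta> the real part in question is x + x^2 - 1/2 on the circle, and (x +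
  1)(1/4 - x) \<ge> 0 makes it negative for x < 1/4. Bending by \<zeta> alone would leave the points
  \<plusminus>i on the edge of the half plane; the quadratic term clears them.\<close>

lemma circle_not_in_left_part:
  assumes "cmod \<zeta> = 1" "0 \<le> Re (\<zeta> + \<zeta>\<^sup>2 / 2)"
  shows "1 / 4 \<le> Re \<zeta>"
proof (rule ccontr)
  assume *: "\<not> 1 / 4 \<le> Re \<zeta>"
  have "(Re \<zeta>)\<^sup>2 + (Im \<zeta>)\<^sup>2 = 1" using assms(1) by (simp add: cmod_def)
  then have im: "Im \<zeta> * Im \<zeta> = 1 - Re \<zeta> * Re \<zeta>" by (simp add: power2_eq_square)
  have "0 \<le> Re \<zeta> + (Re \<zeta> * Re \<zeta> - Im \<zeta> * Im \<zeta>) / 2"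
    using assms(2) by (simp add: power2_eq_square)
  then have "0 \<le> Re \<zeta> + Re \<zeta> * Re \<zeta> - 1 / 2"
    unfolding im by (simp add: diff_divide_distrib)
  moreover have "Re \<zeta> \<ge> -1" using abs_Re_le_cmod[of \<zeta>] assms(1) by linarith
  then have "0 \<le> (Re \<zeta> + 1) * (1 / 4 - Re \<zeta>)"
    using * by (intro mult_nonneg_nonneg) auto
  then have "0 \<le> 1 / 4 - 3 / 4 * Re \<zeta> - Re \<zeta> * Re \<zeta>"
    by (simp add: algebra_simps)
  ultimately show False using * by linarith
qed

text \<open>The disc \<open>\<zeta> \<mapsto> q + \<zeta> v - \<epsilon> (\<zeta> + \<zeta>\<^sup>2 / 2) n\<close> is pushed towards \<open>K\<close> along the outer normal \<open>n\<close>. Its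
  boundary circle never meets \<open>K\<close>: to the left the disc is bent away from the supporting
  hyperplane, and to the right \<open>q + \<zeta> v\<close> keeps a positive distance from \<open>K\<close>.\<close>

lemma complex_tangent_line_not_in_half_plane:
  fixes q v n :: "complex^'n"
  assumes pc: "pseudoconvex_domain \<Omega>" and "closed K" and "\<Omega> \<inter> K = {}"
    and "R > 0" and ball: "ball q R - K \<subseteq> \<Omega>"
    and "q \<in> K" and supp: "\<And>x. x \<in> K \<Longrightarrow> (x - q) \<bullet> n \<le> 0"
    and n1: "norm n = 1" and vn: "herm v n = 0"
    and half0: "\<And>\<zeta>. q + \<zeta> *s v \<in> K \<Longrightarrow> Re \<zeta> \<le> 0"
  shows False
proof -
  \<comment> \<open>Rescaling \<open>v\<close> by \<open>r\<close> keeps the flat disc within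
    \<open>R / 2\<close> of \<open>q\<close>; the half plane condition is unaffected.\<close>
  define r where "r = R / (2 * (norm v + 1))"
  have pos: "norm v + 1 > 0" by (simp add: add_nonneg_pos)
  have "r > 0" using \<open>R > 0\<close> pos by (simp add: r_def)
  define v' where "v' = of_real r *s v"
  have "norm v' \<le> R / 2"
  proof -
    have "norm v' = r * norm v" using \<open>r > 0\<close> by (simp add: v'_def norm_scaleC)
    also have "\<dots> \<le> r * (norm v + 1)" using \<open>r > 0\<close> by (simp add: mult_left_mono)
    also have "\<dots> = R / 2" using pos by (simp add: r_def field_simps)
    finally show ?thesis .
  qed
  have v'n: "herm v' n = 0" by (simp add: v'_def herm_scale vn)
  have half: "Re \<zeta> \<le> 0" if "q + \<zeta> *s v' \<in> K" for \<zeta>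
  proof -
    have "q + (\<zeta> * of_real r) *s v \<in> K" using that by (simp add: v'_def vector_smult_assoc)
    from half0[OF this] show ?thesis using \<open>r > 0\<close> by (simp add: mult_le_0_iff)
  qed
  \<comment> \<open>On this right arc the half plane condition puts \<open>q + \<zeta> *s v'\<close>
    outside \<open>K\<close>, by compactness with a uniform margin \<eta>.\<close>
  define A where "A = sphere (0::complex) 1 \<inter> {\<zeta>. 1 / 4 \<le> Re \<zeta>}"
  have "compact A"
    unfolding A_def by (intro compact_Int_closed compact_sphere closed_halfspace_Re_ge)
  then have "compact ((\<lambda>\<zeta>. q + \<zeta> *s v') ` A)"
    by (intro compact_continuous_image continuous_intros)
  moreover have "(\<lambda>\<zeta>. q + \<zeta> *s v') ` A \<subseteq> - K" using half by (force simp: A_def)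
  ultimately obtain \<eta> where \<eta>: "\<eta> > 0"
      "\<And>x w. x \<in> (\<lambda>\<zeta>. q + \<zeta> *s v') ` A \<Longrightarrow> norm w \<le> \<eta> \<Longrightarrow> x + w \<in> - K"
    using compact_tube_subset_open[of "(\<lambda>\<zeta>. q + \<zeta> *s v') ` A" "- K"] \<open>closed K\<close> by (metis open_Compl)
  \<comment> \<open>The normal displacement is at most
    \<open>\<bar>t\<bar> + 2 * \<epsilon>\<close>, hence at most \<open>6 * \<epsilon>\<close> for
    the times used; this stays below both \<eta> and \<open>R / 4\<close>.\<close>
  define \<epsilon> where "\<epsilon> = min \<eta> (R / 4) / 8"
  have "\<epsilon> > 0" "8 * \<epsilon> \<le> \<eta>" "8 * \<epsilon> \<le> R / 4" using \<eta> \<open>R > 0\<close> by (auto simp: \<epsilon>_def)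
  define s where "s t \<zeta> = of_real t - of_real \<epsilon> * (\<zeta> + \<zeta>\<^sup>2 / 2)" for t :: real and \<zeta> :: complex
  define F where "F t \<zeta> = q + \<zeta> *s v' + s t \<zeta> *s n" for t \<zeta>
  have s_bd: "cmod (s t \<zeta>) \<le> \<bar>t\<bar> + 2 * \<epsilon>" if "cmod \<zeta> \<le> 1" for t \<zeta>
  proof -
    have "cmod (\<zeta> + \<zeta>\<^sup>2 / 2) \<le> cmod \<zeta> + (cmod \<zeta>)\<^sup>2 / 2"
      using norm_triangle_ineq[of \<zeta> "\<zeta>\<^sup>2 / 2"] by (simp add: norm_divide norm_power)
    also have "\<dots> \<le> 2" using that power_le_one[of "cmod \<zeta>" 2] by simp
    finally have "\<epsilon> * cmod (\<zeta> + \<zeta>\<^sup>2 / 2) \<le> \<epsilon> * 2" using \<open>\<epsilon> > 0\<close> by simp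
    moreover have "cmod (s t \<zeta>) \<le> \<bar>t\<bar> + \<epsilon> * cmod (\<zeta> + \<zeta>\<^sup>2 / 2)"
      using norm_triangle_ineq4[of "of_real t" "of_real \<epsilon> * (\<zeta> + \<zeta>\<^sup>2 / 2)"] \<open>\<epsilon> > 0\<close>
      by (simp add: s_def norm_mult)
    ultimately show ?thesis by linarith
  qed
  have F_ball: "F t \<zeta> \<in> ball q R" if "cmod \<zeta> \<le> 1" "\<bar>t\<bar> \<le> 4 * \<epsilon>" for t \<zeta>
  proof -
    have "norm (\<zeta> *s v' + s t \<zeta> *s n) \<le> cmod \<zeta> * norm v' + cmod (s t \<zeta>)"
      using norm_triangle_ineq[of "\<zeta> *s v'" "s t \<zeta> *s n"] by (simp add: norm_scaleC n1)
    also have "cmod \<zeta> * norm v' \<le> norm v'" using that by (simp add: mult_left_le_one_le)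
    finally have "norm (\<zeta> *s v' + s t \<zeta> *s n) < R"
      using \<open>norm v' \<le> R / 2\<close> s_bd[OF that(1), of t] that(2) \<open>8 * \<epsilon> \<le> R / 4\<close> \<open>\<epsilon> > 0\<close> \<open>R > 0\<close> by linarith
    moreover have "dist (F t \<zeta>) q = norm (\<zeta> *s v' + s t \<zeta> *s n)"
      by (simp add: F_def dist_norm add.assoc)
    ultimately show ?thesis by (simp add: dist_commute)
  qed
  have F_K: "0 \<le> \<epsilon> * Re (\<zeta> + \<zeta>\<^sup>2 / 2) - t" if "F t \<zeta> \<in> K" for t \<zeta>
  proof -
    have "(F t \<zeta> - q) \<bullet> n = Re (s t \<zeta>)"
      by (simp add: F_def herm_add herm_scale v'n herm_self n1 flip: Re_herm)
    then show ?thesis using supp[OF that] by (simp add: s_def)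
  qed
  have circ: "F t \<zeta> \<notin> K" if "cmod \<zeta> = 1" "0 \<le> t" "t \<le> 4 * \<epsilon>" for t \<zeta>
  proof
    assume "F t \<zeta> \<in> K"
    then have "0 \<le> \<epsilon> * Re (\<zeta> + \<zeta>\<^sup>2 / 2)" using F_K[of t \<zeta>] that by linarith
    then have "0 \<le> Re (\<zeta> + \<zeta>\<^sup>2 / 2)" using \<open>\<epsilon> > 0\<close> by (simp add: zero_le_mult_iff)
    then have "\<zeta> \<in> A" using circle_not_in_left_part that by (simp add: A_def)
    moreover have "norm (s t \<zeta> *s n) \<le> \<eta>"
      using s_bd[of \<zeta> t] that \<open>8 * \<epsilon> \<le> \<eta>\<close> \<open>\<epsilon> > 0\<close> by (simp add: norm_scaleC n1)
    ultimately have "F t \<zeta> \<in> - K" unfolding F_def by (intro \<eta>(2)) auto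
    then show False using \<open>F t \<zeta> \<in> K\<close> by simp
  qed
  \<comment> \<open>Contacts of the moving discs with \<open>K\<close>, including \<open>q\<close>
    at time 0. Since Re (\<zeta> + \<zeta>^2/2) \<le> 2, none occur after time
    \<open>2 * \<epsilon>\<close>. At the last contact time \<open>t1\<close> the discs of slightly
    later time miss \<open>K\<close> altogether, which is the situation of the
    Kontinuitaetssatz.\<close>
  define S where "S = {z \<in> {0..2 * \<epsilon>} \<times> cball 0 1. F (fst z) (snd z) \<in> K}"
  have "continuous_on UNIV (\<lambda>z. F (fst z) (snd z))"
    unfolding F_def s_def by (intro continuous_intros) auto
  then have "closed ((\<lambda>z. F (fst z) (snd z)) -` K)"
    using \<open>closed K\<close> by (simp add: continuous_on_closed_vimage)
  then have "compact (({0..2 * \<epsilon>} \<times> cball 0 1) \<inter> (\<lambda>z. F (fst z) (snd z)) -` K)"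
    by (intro compact_Int_closed compact_Times) auto
  also have "({0..2 * \<epsilon>} \<times> cball 0 1) \<inter> (\<lambda>z. F (fst z) (snd z)) -` K = S" by (auto simp: S_def)
  finally have "compact S" .
  moreover have "(0, 0) \<in> S" using \<open>q \<in> K\<close> \<open>\<epsilon> > 0\<close> by (simp add: S_def F_def s_def)
  ultimately obtain t1 \<zeta>1 where S1: "(t1, \<zeta>1) \<in> S" and max1: "\<And>z. z \<in> S \<Longrightarrow> fst z \<le> t1"
    using continuous_attains_sup[of S fst] continuous_on_fst[OF continuous_on_id]
    by (metis empty_iff fst_conv surj_pair)
  have t1: "0 \<le> t1" "t1 \<le> 2 * \<epsilon>" "cmod \<zeta>1 \<le> 1" "F t1 \<zeta>1 \<in> K" using S1 by (auto simp: S_def)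
  define a where "a = q + of_real t1 *s n"
  have F_eq: "F t \<zeta> = a + \<zeta> *s (v' - of_real \<epsilon> *s n) + \<zeta>\<^sup>2 *s (- of_real (\<epsilon> / 2) *s n) + (t - t1) *\<^sub>R n" for t \<zeta>
    by (simp add: F_def s_def a_def vec_eq_iff algebra_simps scaleR_conv_of_real[where 'a=complex])
  have F1_eq: "F t1 \<zeta> = a + \<zeta> *s (v' - of_real \<epsilon> *s n) + \<zeta>\<^sup>2 *s (- of_real (\<epsilon> / 2) *s n)" for \<zeta>
    using F_eq[of t1 \<zeta>] by simp
  have "F t1 \<zeta>1 \<in> \<Omega>"
    unfolding F1_eq
  proof (rule kontinuitaetssatz_quadratic_disc[OF pc, where e = "\<epsilon> *\<^sub>R n"], fold F1_eq)
    show "F t1 \<zeta> \<in> \<Omega>" if "cmod \<zeta> = 1" for \<zeta>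
      using circ[OF that, of t1] F_ball[of \<zeta> t1] that t1 \<open>\<epsilon> > 0\<close> ball by auto
    show "F t1 \<zeta> + t *\<^sub>R \<epsilon> *\<^sub>R n \<in> \<Omega>" if "cmod \<zeta> \<le> 1" "0 < t" "t \<le> 1" for \<zeta> t
    proof -
      have te: "0 < t * \<epsilon>" "t * \<epsilon> \<le> \<epsilon>" using that \<open>\<epsilon> > 0\<close> by (auto simp: mult_left_le_one_le)
      have eq: "F t1 \<zeta> + t *\<^sub>R \<epsilon> *\<^sub>R n = F (t1 + t * \<epsilon>) \<zeta>"
        unfolding F_eq[of "t1 + t * \<epsilon>"] F1_eq by simp
      have "F (t1 + t * \<epsilon>) \<zeta> \<notin> K"
      proof
        assume *: "F (t1 + t * \<epsilon>) \<zeta> \<in> K"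
        have "Re (\<zeta> + \<zeta>\<^sup>2 / 2) \<le> 2"
        proof -
          have "cmod (\<zeta>\<^sup>2) \<le> 1" using that by (simp add: norm_power power_le_one)
          then show ?thesis
            using complex_Re_le_cmod[of \<zeta>] complex_Re_le_cmod[of "\<zeta>\<^sup>2"] that by simp
        qed
        then have "\<epsilon> * Re (\<zeta> + \<zeta>\<^sup>2 / 2) \<le> \<epsilon> * 2" using \<open>\<epsilon> > 0\<close> by simp
        then have "t1 + t * \<epsilon> \<le> 2 * \<epsilon>" using F_K[OF *] by linarith
        then have "(t1 + t * \<epsilon>, \<zeta>) \<in> S" using * that te t1 by (simp add: S_def)
        from max1[OF this] show False using te by simp
      qed
      then show ?thesis
        using F_ball[OF that(1), of "t1 + t * \<epsilon>"] te t1 ball unfolding eq by auto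
    qed
  qed (rule t1)
  then show False using t1 \<open>\<Omega> \<inter> K = {}\<close> by blast
qed

text \<open>Otherwise the slice \<open>F\<close> of \<open>K\<close> by the complex line is a closed
  convex planar set missing 1. It lies in a half plane bounded through the nearest point
  \<open>\<tau>0\<close>, and moving the base point there contradicts the previous lemma:
  \<open>q0\<close> is still on the supporting hyperplane, because \<open>v\<close> is complex
  tangent. Projection onto \<open>F\<close> is nonexpansive and fixes 0, so \<bar>\<tau>0\<bar>
  \<le> 1 and \<open>q0\<close> remains in the ball.\<close>

lemma complex_tangent_ball_subset:
  fixes q v n :: "complex^'n"
  assumes pc: "pseudoconvex_domain \<Omega>" and K: "closed K" "convex K" and disj: "\<Omega> \<inter> K = {}"
    and ball: "ball q R - K \<subseteq> \<Omega>"
    and "q \<in> K" and supp: "\<And>x. x \<in> K \<Longrightarrow> (x - q) \<bullet> n \<le> 0"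
    and n1: "norm n = 1" and vn: "herm v n = 0" and "norm v < R"
  shows "q + v \<in> K"
proof (rule ccontr)
  assume nK: "q + v \<notin> K"
  define F where "F = (\<lambda>\<tau>. q + \<tau> *s v) -` K"
  have "closed F"
    unfolding F_def using K(1)
    by (intro continuous_closed_vimage) (auto intro!: continuous_on_interior[of UNIV] continuous_intros)
  have "convex F"
    unfolding convex_alt
  proof (intro ballI allI impI)
    fix x y and u :: real assume "x \<in> F" "y \<in> F" "0 \<le> u \<and> u \<le> 1"
    then have "(1 - u) *\<^sub>R (q + x *s v) + u *\<^sub>R (q + y *s v) \<in> K"
      using K(2) unfolding convex_alt F_def by blast
    also have "(1 - u) *\<^sub>R (q + x *s v) + u *\<^sub>R (q + y *s v) = q + ((1 - u) *\<^sub>R x + u *\<^sub>R y) *s v"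
      by (simp add: vec_eq_iff algebra_simps scaleR_conv_of_real[where 'a=complex])
    finally show "(1 - u) *\<^sub>R x + u *\<^sub>R y \<in> F" by (simp add: F_def)
  qed
  have "0 \<in> F" using \<open>q \<in> K\<close> by (simp add: F_def)
  have "1 \<notin> F" using nK by (simp add: F_def)
  define \<tau>0 where "\<tau>0 = closest_point F 1"
  have "\<tau>0 \<in> F"
    unfolding \<tau>0_def using \<open>closed F\<close> \<open>0 \<in> F\<close> by (intro closest_point_in_set) auto
  have "cmod \<tau>0 \<le> 1"
    using closest_point_lipschitz[OF \<open>convex F\<close> \<open>closed F\<close>, of 1 0] \<open>0 \<in> F\<close>
    by (auto simp: \<tau>0_def closest_point_self)
  have obt: "(1 - \<tau>0) \<bullet> (\<tau> - \<tau>0) \<le> 0" if "\<tau> \<in> F" for \<tau>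
    unfolding \<tau>0_def using \<open>convex F\<close> \<open>closed F\<close> that by (rule closest_point_dot)
  \<comment> \<open>As a complex factor of \<open>v\<close>, \<open>d\<close> turns the half plane
    into \<open>Re \<zeta> \<le> 0\<close>, since \<open>d \<bullet> (\<zeta> * d)\<close> is
    \<open>Re \<zeta>\<close> times a positive number.\<close>
  define d where "d = 1 - \<tau>0"
  have "d \<noteq> 0" using \<open>1 \<notin> F\<close> \<open>\<tau>0 \<in> F\<close> by (auto simp: d_def)
  define q0 where "q0 = q + \<tau>0 *s v"
  have "norm (\<tau>0 *s v) < R"
    using \<open>cmod \<tau>0 \<le> 1\<close> \<open>norm v < R\<close> mult_left_le_one_le[of "norm v" "cmod \<tau>0"]
    by (simp add: norm_scaleC)
  show False
  proof (rule complex_tangent_line_not_in_half_plane[OF pc K(1) disj])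
    show "0 < R - norm (\<tau>0 *s v)" using \<open>norm (\<tau>0 *s v) < R\<close> by simp
    have "ball q0 (R - norm (\<tau>0 *s v)) \<subseteq> ball q R"
    proof
      fix x assume "x \<in> ball q0 (R - norm (\<tau>0 *s v))"
      moreover have "dist q x \<le> dist q0 x + norm (\<tau>0 *s v)"
        using dist_triangle[of q x q0] by (simp add: q0_def dist_norm)
      ultimately show "x \<in> ball q R" by simp
    qed
    then show "ball q0 (R - norm (\<tau>0 *s v)) - K \<subseteq> \<Omega>" using ball by blast
    show "q0 \<in> K" using \<open>\<tau>0 \<in> F\<close> by (simp add: q0_def F_def)
    have "(\<tau>0 *s v) \<bullet> n = 0" by (simp add: scaleC_inner vn)
    then show "(x - q0) \<bullet> n \<le> 0" if "x \<in> K" for x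
      using supp[OF that] by (simp add: q0_def inner_diff inner_add)
    show "herm (d *s v) n = 0" by (simp add: herm_scale vn)
    show "Re \<zeta> \<le> 0" if "q0 + \<zeta> *s (d *s v) \<in> K" for \<zeta>
    proof -
      have "\<tau>0 + \<zeta> * d \<in> F"
        using that by (simp add: F_def q0_def vector_smult_assoc vector_sadd_rdistrib add.assoc)
      from obt[OF this] have "d \<bullet> (\<zeta> * d) \<le> 0" by (simp add: d_def)
      also have "d \<bullet> (\<zeta> * d) = Re \<zeta> * (cmod d)\<^sup>2"
        unfolding cmod_power2 by (simp add: inner_complex_def power2_eq_square algebra_simps)
      finally show ?thesis using \<open>d \<noteq> 0\<close> by (simp add: mult_le_0_iff)
    qed
  qed (rule n1)
qed

section \<open>Supporting normals\<close>

text \<open>Does the work of the implicit function theorem: for small \<tau>, \<rho> is positive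
  along \<open>h + \<epsilon> *\<^sub>R g\<close> and negative along
  \<open>h - \<epsilon> *\<^sub>R g\<close>, so it vanishes in between.\<close>

lemma zero_set_near_tangent_direction:
  fixes \<rho> :: "'a::euclidean_space \<Rightarrow> real"
  assumes "open W" "q \<in> W" "\<rho> q = 0" and der: "(\<rho> has_derivative (\<lambda>h. g \<bullet> h)) (at q)"
    and "g \<noteq> 0" and cont: "continuous_on W \<rho>" and "g \<bullet> h = 0" and "\<epsilon> > 0"
  obtains \<tau> \<sigma> where "\<tau> > 0" "\<bar>\<sigma>\<bar> \<le> \<epsilon>" "q + \<tau> *\<^sub>R (h + \<sigma> *\<^sub>R g) \<in> W" "\<rho> (q + \<tau> *\<^sub>R (h + \<sigma> *\<^sub>R g)) = 0"
proof -
  have line: "((\<lambda>\<tau>. \<rho> (q + \<tau> *\<^sub>R w)) has_real_derivative (g \<bullet> w)) (at 0)" for w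
  proof -
    have "((\<lambda>\<tau>::real. q + \<tau> *\<^sub>R w) has_derivative (\<lambda>\<tau>. \<tau> *\<^sub>R w)) (at 0)"
      by (auto intro!: derivative_eq_intros)
    from has_derivative_compose[OF this, of \<rho> "\<lambda>h. g \<bullet> h"] der show ?thesis
      by (simp add: has_field_derivative_def mult_commute_abs)
  qed
  have gg: "g \<bullet> g > 0" using \<open>g \<noteq> 0\<close> by simp
  obtain d1 where d1: "d1 > 0" "\<And>\<tau>. 0 < \<tau> \<Longrightarrow> \<tau> < d1 \<Longrightarrow> 0 < \<rho> (q + \<tau> *\<^sub>R (h + \<epsilon> *\<^sub>R g))"
    using DERIV_pos_inc_right[OF line[of "h + \<epsilon> *\<^sub>R g"]] gg \<open>\<epsilon> > 0\<close> \<open>g \<bullet> h = 0\<close> \<open>\<rho> q = 0\<close>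
    by (auto simp: inner_add_right)
  obtain d2 where d2: "d2 > 0" "\<And>\<tau>. 0 < \<tau> \<Longrightarrow> \<tau> < d2 \<Longrightarrow> \<rho> (q + \<tau> *\<^sub>R (h + (- \<epsilon>) *\<^sub>R g)) < 0"
    using DERIV_neg_dec_right[OF line[of "h + (- \<epsilon>) *\<^sub>R g"]] gg \<open>\<epsilon> > 0\<close> \<open>g \<bullet> h = 0\<close> \<open>\<rho> q = 0\<close>
    by (auto simp: inner_diff_right)
  obtain r where r: "r > 0" "ball q r \<subseteq> W" using assms(1,2) open_contains_ball by blast
  define B where "B = norm h + \<epsilon> * norm g + 1"
  have "B > 0" using \<open>\<epsilon> > 0\<close> by (simp add: B_def add_nonneg_pos)
  define c where "c = min (min d1 d2) (r / B)"
  define \<tau> where "\<tau> = c / 2"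
  have \<tau>: "0 < \<tau>" "\<tau> < d1" "\<tau> < d2" "\<tau> < r / B"
  proof -
    have "0 < c" "c \<le> d1" "c \<le> d2" "c \<le> r / B" using d1 d2 r \<open>B > 0\<close> by (simp_all add: c_def)
    moreover have "\<tau> < c" "0 < \<tau>" using \<open>0 < c\<close> by (simp_all add: \<tau>_def)
    ultimately show "0 < \<tau>" "\<tau> < d1" "\<tau> < d2" "\<tau> < r / B" by (blast intro: less_le_trans)+
  qed
  have inW: "q + \<tau> *\<^sub>R (h + \<sigma> *\<^sub>R g) \<in> W" if "\<bar>\<sigma>\<bar> \<le> \<epsilon>" for \<sigma>
  proof -
    have "norm (h + \<sigma> *\<^sub>R g) \<le> norm h + \<bar>\<sigma>\<bar> * norm g"
      using norm_triangle_ineq[of h "\<sigma> *\<^sub>R g"] by simp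
    also have "\<dots> < B" using that mult_right_mono[OF that, of "norm g"] by (simp add: B_def)
    finally have "\<tau> * norm (h + \<sigma> *\<^sub>R g) \<le> \<tau> * B" using \<tau> by simp
    also have "\<dots> < r" using \<tau> \<open>B > 0\<close> by (simp add: pos_less_divide_eq)
    finally have "q + \<tau> *\<^sub>R (h + \<sigma> *\<^sub>R g) \<in> ball q r" using \<tau> by (simp add: dist_norm)
    then show ?thesis using r by blast
  qed
  have "\<exists>\<sigma>. - \<epsilon> \<le> \<sigma> \<and> \<sigma> \<le> \<epsilon> \<and> \<rho> (q + \<tau> *\<^sub>R (h + \<sigma> *\<^sub>R g)) = 0"
  proof (rule IVT')
    show "continuous_on {- \<epsilon>..\<epsilon>} (\<lambda>\<sigma>. \<rho> (q + \<tau> *\<^sub>R (h + \<sigma> *\<^sub>R g)))"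
      by (rule continuous_on_compose2[OF cont]) (auto intro!: continuous_intros inW simp: abs_le_iff)
  qed (use d1(2)[of \<tau>] d2(2)[of \<tau>] \<tau> \<open>\<epsilon> > 0\<close> in auto)
  then obtain \<sigma> where "\<bar>\<sigma>\<bar> \<le> \<epsilon>" "\<rho> (q + \<tau> *\<^sub>R (h + \<sigma> *\<^sub>R g)) = 0"
    by (metis abs_le_iff minus_le_iff)
  then show ?thesis using that \<tau>(1) inW by blast
qed

text \<open>Let \<open>h\<close> be the part of \<open>a\<close> orthogonal to \<open>g\<close>. The
  zero set has points in directions arbitrarily close to \<open>h\<close>, so the support inequality
  gives \<open>h \<bullet> a \<le> 0\<close>; but \<open>h \<bullet> a\<close> is the squared length
  of \<open>h\<close>.\<close>

lemma supporting_normal_parallel_gradient: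
  fixes \<rho> :: "'a::euclidean_space \<Rightarrow> real"
  assumes "open W" "q \<in> W" "\<rho> q = 0" and der: "(\<rho> has_derivative (\<lambda>h. g \<bullet> h)) (at q)"
    and "g \<noteq> 0" and cont: "continuous_on W \<rho>"
    and supp: "\<And>x. x \<in> W \<Longrightarrow> \<rho> x = 0 \<Longrightarrow> (x - q) \<bullet> a \<le> 0"
  shows "a = ((a \<bullet> g) / (g \<bullet> g)) *\<^sub>R g"
proof -
  define h where "h = a - ((a \<bullet> g) / (g \<bullet> g)) *\<^sub>R g"
  have gh: "g \<bullet> h = 0" using \<open>g \<noteq> 0\<close> by (simp add: h_def inner_diff_right inner_commute)
  have le: "h \<bullet> a \<le> \<epsilon> * \<bar>g \<bullet> a\<bar>" if "\<epsilon> > 0" for \<epsilon>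
  proof -
    obtain \<tau> \<sigma> where *: "\<tau> > 0" "\<bar>\<sigma>\<bar> \<le> \<epsilon>" "q + \<tau> *\<^sub>R (h + \<sigma> *\<^sub>R g) \<in> W" "\<rho> (q + \<tau> *\<^sub>R (h + \<sigma> *\<^sub>R g)) = 0"
      using zero_set_near_tangent_direction[OF assms(1-6) gh \<open>\<epsilon> > 0\<close>] by blast
    then have "\<tau> * ((h + \<sigma> *\<^sub>R g) \<bullet> a) \<le> 0" using supp[OF *(3,4)] by simp
    then have "h \<bullet> a \<le> - \<sigma> * (g \<bullet> a)" using \<open>\<tau> > 0\<close> by (simp add: mult_le_0_iff inner_add_left)
    also have "\<dots> \<le> \<bar>\<sigma>\<bar> * \<bar>g \<bullet> a\<bar>" by (metis abs_ge_self abs_minus_cancel abs_mult)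
    also have "\<dots> \<le> \<epsilon> * \<bar>g \<bullet> a\<bar>" using *(2) by (simp add: mult_right_mono)
    finally show ?thesis .
  qed
  have "h \<bullet> a \<le> 0"
  proof (rule ccontr)
    assume "\<not> h \<bullet> a \<le> 0"
    then show False
      using le[of "h \<bullet> a / (2 * (\<bar>g \<bullet> a\<bar> + 1))"] by (simp add: field_simps) (smt (verit) mult_nonneg_nonneg)
  qed
  moreover have "h \<bullet> a = h \<bullet> h"
    using gh by (simp add: h_def inner_diff_right inner_commute algebra_simps)
  ultimately have "h = 0" by (metis inner_gt_zero_iff not_le)
  then show ?thesis by (simp add: h_def)
qed

text \<open>The vector \<open>n - herm n n' *s n'\<close> is the projection of \<open>n\<close> to
  the complex tangent space at \<open>q'\<close>. Going from \<open>q'\<close> a distance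
  \<open>R\<close> in its direction stays in \<open>K\<close>, and the support inequality at
  \<open>q\<close> for the end point is the claim.\<close>

lemma normal_distance_le:
  fixes q q' n n' :: "complex^'n"
  assumes "norm n = 1" "norm n' = 1" "R \<ge> 0"
    and supp: "\<And>x. x \<in> K \<Longrightarrow> (x - q) \<bullet> n \<le> 0"
    and tang: "\<And>v. herm v n' = 0 \<Longrightarrow> norm v \<le> R \<Longrightarrow> q' + v \<in> K"
  shows "R * norm (n - herm n n' *s n') \<le> (q - q') \<bullet> n"
proof (cases "n - herm n n' *s n' = 0")
  case True
  have "q' + 0 \<in> K" by (rule tang) (use \<open>R \<ge> 0\<close> in \<open>auto simp: herm_def\<close>)
  from supp[OF this] True show ?thesis by (simp add: inner_diff_left)
next
  case False
  define v where "v = n - herm n n' *s n'"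
  have vn': "herm v n' = 0"
    using assms by (simp add: v_def herm_diff herm_scale herm_self)
  have "v \<bullet> v = v \<bullet> n"
  proof -
    have "v \<bullet> (herm n n' *s n') = 0"
      by (simp add: inner_commute[of v] scaleC_inner flip: herm_cnj[of v n']) (simp add: vn')
    then show ?thesis by (simp add: v_def inner_diff_right)
  qed
  define w where "w = (R / norm v) *\<^sub>R v"
  have "w = of_real (R / norm v) *s v"
    by (simp add: w_def vec_eq_iff scaleR_conv_of_real[where 'a=complex])
  then have "herm w n' = 0" by (simp add: herm_scale vn')
  moreover have "norm w \<le> R" using False \<open>R \<ge> 0\<close> by (simp add: w_def v_def)
  ultimately have "(q' + w - q) \<bullet> n \<le> 0" by (intro supp tang)
  moreover have "w \<bullet> n = R * norm v"
    using \<open>v \<bullet> v = v \<bullet> n\<close>[symmetric] False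
    by (simp add: w_def power2_norm_eq_inner[symmetric] power2_eq_square)
  ultimately show ?thesis by (simp add: v_def inner_diff_left inner_add_left)
qed

text \<open>Pythagoras for the angle between the complex lines of \<open>n\<close> and
  \<open>n'\<close>. The right side shows that the left one is symmetric in the two vectors.\<close>

lemma herm_distance_sq:
  assumes "norm n = 1" "norm n' = 1"
  shows "(norm (n - herm n n' *s n'))\<^sup>2 = 1 - (cmod (herm n n'))\<^sup>2"
proof -
  let ?c = "herm n n'"
  have "(norm (n - ?c *s n'))\<^sup>2 = n \<bullet> n - 2 * ((?c *s n') \<bullet> n) + (norm (?c *s n'))\<^sup>2"
    by (simp add: power2_norm_eq_inner inner_diff_left inner_diff_right inner_commute)
  also have "(?c *s n') \<bullet> n = Re (?c * cnj ?c)"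
    by (simp add: scaleC_inner herm_cnj)
  also have "\<dots> = (cmod ?c)\<^sup>2" by (simp add: complex_mult_cnj cmod_power2)
  also have "n \<bullet> n = 1" using assms by (simp flip: power2_norm_eq_inner)
  finally show ?thesis using assms by (simp add: norm_scaleC)
qed

text \<open>Splitting one unit vector along the other bounds the difference from one side, and the
  symmetry of the distance gives the other. The modulus makes the compared quantity depend only on
  the complex lines, not on the phases of the normals.\<close>

lemma cmod_herm_diff_le:
  assumes "norm n = 1" "norm n' = 1" "norm m = 1"
  shows "\<bar>cmod (herm n m) - cmod (herm n' m)\<bar> \<le> norm (n - herm n n' *s n')"
proof -
  have le: "cmod (herm x m) - cmod (herm y m) \<le> norm (x - herm x y *s y)"
    if "norm x = 1" "norm y = 1" for x y
  proof -
    have "herm x m = herm x y * herm y m + herm (x - herm x y *s y) m"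
      by (simp add: herm_diff herm_scale)
    then have "cmod (herm x m) \<le> cmod (herm x y) * cmod (herm y m) + cmod (herm (x - herm x y *s y) m)"
      by (metis norm_mult norm_triangle_ineq)
    also have "\<dots> \<le> cmod (herm y m) + norm (x - herm x y *s y)"
      using norm_herm_le[of x y] norm_herm_le[of "x - herm x y *s y" m] that assms
      by (intro add_mono) (auto simp: mult_left_le_one_le)
    finally show ?thesis by simp
  qed
  have "cmod (herm n n') = cmod (herm n' n)"
    by (metis complex_mod_cnj herm_cnj)
  then have "(norm (n - herm n n' *s n'))\<^sup>2 = (norm (n' - herm n' n *s n))\<^sup>2"
    using assms by (simp add: herm_distance_sq)
  then have "norm (n - herm n n' *s n') = norm (n' - herm n' n *s n)" by simp
  then show ?thesis using le[of n n'] le[of n' n] assms by linarith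
qed

section \<open>Constancy of the complex tangent hyperplane\<close>

text \<open>\<open>P\<close> is the convex side, \<Omega> the opposite one, and \<open>K - P\<close>
  stands for the hypersurface. The radius \<open>4 * R\<close> leaves a ball of radius
  \<open>2 * R\<close> around every point within \<open>2 * R\<close> of \<open>p\<close>.\<close>

locale convex_levi_flat =
  fixes K P \<Omega> :: "(complex^'n) set" and p :: "complex^'n" and R :: real
  assumes pc: "pseudoconvex_domain \<Omega>" and disj: "\<Omega> \<inter> K = {}"
    and ball: "ball p (4 * R) - K \<subseteq> \<Omega>" and R: "R > 0"
    and P: "open P" "convex P" "P \<noteq> {}" and K: "K = closure P"
    and p: "p \<in> K - P"
    and C1: "\<And>q. q \<in> K - P \<Longrightarrow> q \<in> ball p (4 * R) \<Longrightarrow> \<exists>W \<rho> g. open W \<and> q \<in> W \<and>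
        continuous_on W g \<and>
        (\<forall>x\<in>W. (\<rho> has_derivative (\<lambda>h. g x \<bullet> h)) (at x) \<and> g x \<noteq> 0) \<and>
        (K - P) \<inter> W = {x\<in>W. \<rho> x = (0::real)}"
begin

definition supports :: "complex^'n \<Rightarrow> complex^'n \<Rightarrow> bool" where
  "supports n q \<longleftrightarrow> norm n = 1 \<and> (\<forall>x\<in>K. (x - q) \<bullet> n \<le> 0)"

lemma closed_K: "closed K" and convex_K: "convex K" and P_sub: "P \<subseteq> K"
  using P by (auto simp: K convex_closure closure_subset)

lemma supports_exists:
  assumes "q \<in> K - P"
  shows "\<exists>n. supports n q"
proof -
  obtain a b where a: "a \<noteq> 0" "\<And>x. x \<in> P \<Longrightarrow> a \<bullet> x \<le> b" "b \<le> a \<bullet> q"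
    using separating_hyperplane_sets[of P "{q}"] P assms by auto
  have "K \<subseteq> {x. a \<bullet> x \<le> a \<bullet> q}"
    unfolding K using a by (intro closure_minimal closed_halfspace_le) force
  then have "(x - q) \<bullet> a \<le> 0" if "x \<in> K" for x
    using that by (force simp: inner_diff_left inner_commute[of a])
  then have "supports (a /\<^sub>R norm a) q"
    using a(1) by (auto simp: supports_def mult_le_0_iff)
  then show ?thesis ..
qed

text \<open>A point of the open set \<open>P\<close> on the hyperplane could be pushed across it
  along \<open>n\<close> without leaving \<open>P\<close>.\<close>

lemma supporting_not_in_P:
  assumes "supports n q" "(x - q) \<bullet> n = 0"
  shows "x \<notin> P"
proof
  assume "x \<in> P"
  then obtain e where e: "e > 0" "ball x e \<subseteq> P" using P open_contains_ball by blast
  have "x + (e / 2) *\<^sub>R n \<in> ball x e" using assms e by (simp add: supports_def dist_norm)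
  then have "x + (e / 2) *\<^sub>R n \<in> K" using e P_sub by blast
  then have "(x + (e / 2) *\<^sub>R n - q) \<bullet> n \<le> 0" using assms by (auto simp: supports_def)
  moreover have "n \<bullet> n = 1" using assms by (simp add: supports_def flip: power2_norm_eq_inner)
  ultimately show False using assms(2) e by (simp add: inner_diff_left inner_add_left)
qed

lemma complex_tangent:
  assumes "q \<in> K" "q \<in> ball p (2 * R)" "supports n q" "herm v n = 0" "norm v < 2 * R"
  shows "q + v \<in> K - P"
proof -
  have "ball q (2 * R) \<subseteq> ball p (4 * R)"
  proof
    fix x assume "x \<in> ball q (2 * R)"
    then show "x \<in> ball p (4 * R)" using assms(2) dist_triangle[of p x q] by simp
  qed
  then have "ball q (2 * R) - K \<subseteq> \<Omega>" using ball by blast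
  moreover have "norm n = 1" "\<And>x. x \<in> K \<Longrightarrow> (x - q) \<bullet> n \<le> 0"
    using assms by (auto simp: supports_def)
  ultimately have "q + v \<in> K"
    using complex_tangent_ball_subset[OF pc closed_K convex_K disj, of q "2 * R" n v] assms by blast
  moreover have "v \<bullet> n = 0" using assms(4) by (simp flip: Re_herm)
  then have "q + v \<notin> P" by (intro supporting_not_in_P[OF assms(3)]) simp
  ultimately show ?thesis by simp
qed

lemma supports_gradient:
  assumes q: "q \<in> K - P" "q \<in> W" and n: "supports n q" and W: "open W"
    "\<forall>x\<in>W. (\<rho> has_derivative (\<lambda>h. g x \<bullet> h)) (at x) \<and> g x \<noteq> 0"
    "(K - P) \<inter> W = {x\<in>W. \<rho> x = (0::real)}"
  shows "n = ((n \<bullet> g q) / (g q \<bullet> g q)) *\<^sub>R g q"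
proof (rule supporting_normal_parallel_gradient[OF W(1) q(2)])
  show "continuous_on W \<rho>"
    using W(2) by (meson continuous_at_imp_continuous_on has_derivative_continuous)
  show "(x - q) \<bullet> n \<le> 0" if "x \<in> W" "\<rho> x = 0" for x
    using n that W(3) unfolding supports_def by blast
qed (use W q in auto)

text \<open>Both unit normals are multiples of the gradient, hence equal up to sign. Opposite
  normals would squeeze the open set \<open>P\<close> into a hyperplane.\<close>

lemma supports_unique:
  assumes q: "q \<in> K - P" "q \<in> ball p (4 * R)" and n: "supports n q" "supports m q"
  shows "n = m"
proof -
  obtain W \<rho> g where W: "open W" "q \<in> W"
    "\<forall>x\<in>W. (\<rho> has_derivative (\<lambda>h. g x \<bullet> h)) (at x) \<and> g x \<noteq> 0"
    "(K - P) \<inter> W = {x\<in>W. \<rho> x = (0::real)}"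
    using C1[OF q] by auto
  obtain c where c: "n = c *\<^sub>R g q" using supports_gradient[OF q(1) W(2) n(1) W(1,3,4)] ..
  obtain d where d: "m = d *\<^sub>R g q" using supports_gradient[OF q(1) W(2) n(2) W(1,3,4)] ..
  have "\<bar>c\<bar> * norm (g q) = 1" "\<bar>d\<bar> * norm (g q) = 1" using n c d by (auto simp: supports_def)
  then have "\<bar>c\<bar> = \<bar>d\<bar>" by (metis mult_cancel_right mult_zero_right zero_neq_one)
  moreover have "c \<noteq> - d"
  proof
    assume "c = - d"
    then have mn: "m = - n" using c d by simp
    obtain x where x: "x \<in> P" using P by blast
    then have "(x - q) \<bullet> n \<le> 0" "(x - q) \<bullet> m \<le> 0" using n P_sub by (auto simp: supports_def)
    then have "(x - q) \<bullet> n = 0" by (simp add: mn)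
    then show False using supporting_not_in_P[OF n(1)] x by blast
  qed
  ultimately have "c = d" by linarith
  then show ?thesis using c d by simp
qed

text \<open>The normal is a multiple of the gradient, and \<rho> vanishes at both points, so the
  bound is the remainder estimate for the derivative.\<close>

lemma supports_first_order:
  assumes q: "q \<in> K - P" "q \<in> ball p (4 * R)" and n: "supports n q" and "e > 0"
  shows "\<exists>d>0. \<forall>x\<in>K - P. norm (x - q) < d \<longrightarrow> \<bar>(x - q) \<bullet> n\<bar> \<le> e * norm (x - q)"
proof -
  obtain W \<rho> g where W: "open W" "q \<in> W"
    "\<forall>x\<in>W. (\<rho> has_derivative (\<lambda>h. g x \<bullet> h)) (at x) \<and> g x \<noteq> 0"
    "(K - P) \<inter> W = {x\<in>W. \<rho> x = (0::real)}"
    using C1[OF q] by auto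
  obtain c where c: "n = c *\<^sub>R g q" using supports_gradient[OF q(1) W(2) n W(1,3,4)] ..
  have "c \<noteq> 0" using n c by (auto simp: supports_def)
  obtain r where r: "r > 0" "ball q r \<subseteq> W" using W open_contains_ball by blast
  have "e / \<bar>c\<bar> > 0" using \<open>e > 0\<close> \<open>c \<noteq> 0\<close> by simp
  then obtain d where d: "d > 0"
    "\<And>y. norm (y - q) < d \<Longrightarrow> norm (\<rho> y - \<rho> q - g q \<bullet> (y - q)) \<le> e / \<bar>c\<bar> * norm (y - q)"
    using W(2,3) unfolding has_derivative_at_alt by blast
  have "\<bar>(x - q) \<bullet> n\<bar> \<le> e * norm (x - q)" if "x \<in> K - P" "norm (x - q) < min d r" for x
  proof -
    have "x \<in> W" using that r by (auto simp: dist_norm norm_minus_commute)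
    then have "\<rho> x = 0" using W(4) that by blast
    moreover have "\<rho> q = 0" using W q by blast
    ultimately have "\<bar>g q \<bullet> (x - q)\<bar> \<le> e / \<bar>c\<bar> * norm (x - q)" using d(2)[of x] that by simp
    then have "\<bar>c\<bar> * \<bar>g q \<bullet> (x - q)\<bar> \<le> e * norm (x - q)"
      using \<open>c \<noteq> 0\<close> by (simp add: field_simps)
    then show ?thesis by (simp add: c abs_mult inner_commute)
  qed
  then show ?thesis using d(1) r(1) by (intro exI[of _ "min d r"]) auto
qed

text \<open>Compactness of the unit sphere: normals at points tending to \<open>p\<close> accumulate
  at a supporting normal of \<open>p\<close>, which is \<open>n\<close> by uniqueness.\<close>

lemma supports_near_p:
  assumes n: "supports n p"
  shows "\<exists>r>0. \<forall>q m. q \<in> K - P \<longrightarrow> norm (q - p) < r \<longrightarrow> supports m q \<longrightarrow> 1 / 2 \<le> m \<bullet> n"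
proof (rule ccontr)
  assume "\<not> ?thesis"
  then have "\<forall>i. \<exists>q m. norm (q - p) < inverse (real (Suc i)) \<and> supports m q \<and> m \<bullet> n < 1 / 2"
    by (metis inverse_positive_iff_positive linorder_not_le of_nat_0_less_iff zero_less_Suc)
  then obtain q m where qm: "\<And>i. norm (q i - p) < inverse (real (Suc i))"
      "\<And>i. supports (m i) (q i)" "\<And>i. m i \<bullet> n < 1 / 2"
    by metis
  have "q \<longlonglongrightarrow> p"
  proof -
    have "(\<lambda>i. norm (q i - p)) \<longlonglongrightarrow> 0"
      by (rule tendsto_sandwich[OF _ _ tendsto_const LIMSEQ_inverse_real_of_nat])
         (use qm(1) in \<open>auto intro!: always_eventually less_imp_le simp del: of_nat_Suc\<close>)
    then have "(\<lambda>i. q i - p) \<longlonglongrightarrow> 0" by (rule tendsto_norm_zero_cancel)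
    then show ?thesis by (rule LIM_zero_cancel)
  qed
  have "\<forall>i. m i \<in> sphere 0 1" using qm by (simp add: supports_def)
  then obtain a s where a: "a \<in> sphere 0 1" "strict_mono s" "(m \<circ> s) \<longlonglongrightarrow> a"
    using compact_sphere[of 0 1] unfolding compact_def by metis
  have qs: "(q \<circ> s) \<longlonglongrightarrow> p" using \<open>q \<longlonglongrightarrow> p\<close> a(2) by (rule LIMSEQ_subseq_LIMSEQ)
  have "(x - p) \<bullet> a \<le> 0" if "x \<in> K" for x
  proof (rule LIMSEQ_le_const2)
    show "(\<lambda>i. (x - (q \<circ> s) i) \<bullet> (m \<circ> s) i) \<longlonglongrightarrow> (x - p) \<bullet> a"
      by (intro tendsto_intros qs a)
    show "\<exists>N. \<forall>i\<ge>N. (x - (q \<circ> s) i) \<bullet> (m \<circ> s) i \<le> 0"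
      using qm(2) that by (auto simp: supports_def)
  qed
  then have "supports a p" using a by (simp add: supports_def)
  then have "a = n" using supports_unique[OF p _ _ n] R by simp
  have "a \<bullet> n \<le> 1 / 2"
  proof (rule LIMSEQ_le_const2)
    show "(\<lambda>i. (m \<circ> s) i \<bullet> n) \<longlonglongrightarrow> a \<bullet> n" by (intro tendsto_intros a)
    show "\<exists>N. \<forall>i\<ge>N. (m \<circ> s) i \<bullet> n \<le> 1 / 2" using qm(3) by (auto intro: less_imp_le)
  qed
  moreover have "n \<bullet> n = 1" using n by (simp add: supports_def flip: power2_norm_eq_inner)
  ultimately show False using \<open>a = n\<close> by simp
qed

text \<open>Used to see that the nearest point map reaches all boundary points near
  \<open>p\<close>: each is the image of points further out along its normal.\<close>

lemma closest_point_supports: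
  assumes "q \<in> K" "supports n q" "t \<ge> 0"
  shows "closest_point K (q + t *\<^sub>R n) = q"
proof (rule closest_point_unique[symmetric, OF convex_K closed_K \<open>q \<in> K\<close>], intro ballI)
  fix z assume "z \<in> K"
  have nn: "norm n = 1" "n \<bullet> n = 1"
    using assms by (simp_all add: supports_def flip: power2_norm_eq_inner)
  have "t \<le> (q + t *\<^sub>R n - z) \<bullet> n"
    using assms \<open>z \<in> K\<close> nn by (auto simp: supports_def inner_diff_left inner_add_left)
  also have "\<dots> \<le> norm (q + t *\<^sub>R n - z)" using norm_cauchy_schwarz[of _ n] nn by (metis mult.right_neutral)
  finally show "dist (q + t *\<^sub>R n) q \<le> dist (q + t *\<^sub>R n) z"
    using assms nn by (simp add: dist_norm)
qed

text \<open>By \<open>normal_distance_le\<close> the complex normal line varies to second order only, and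
  \<open>closest_point K\<close> is a nonexpansive parametrisation of the boundary by a convex open set.\<close>

lemma complex_normal_constant:
  assumes n: "supports n p"
  shows "\<exists>r>0. \<forall>q m. q \<in> K - P \<longrightarrow> norm (q - p) < r \<longrightarrow> supports m q \<longrightarrow>
    cmod (herm m n) = 1"
proof -
  \<comment> \<open>An arbitrary choice, evaluated only at points of \<open>K - P\<close> near
    \<open>p\<close>, where the supporting normal is unique.\<close>
  define N where "N q = (SOME m. supports m q)" for q
  have N: "supports (N q) q" if "q \<in> K - P" for q
    unfolding N_def using supports_exists[OF that] by (rule someI_ex)
  have N_p: "N p = n" using supports_unique[OF p _ N[OF p] n] R by simp
  define \<pi> where "\<pi> = closest_point K"
  have "K \<noteq> {}" using p by blast
  \<comment> \<open>A half ball beyond the supporting hyperplane at \<open>p\<close>. It misses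
    \<open>K\<close>, so its points project to the boundary, and its convexity allows a function
    with zero derivative to be recognised as constant.\<close>
  define D where "D = ball p R \<inter> {y. 0 < n \<bullet> (y - p)}"
  have "{y. 0 < n \<bullet> (y - p)} = {y. n \<bullet> p < n \<bullet> y}" by (auto simp: inner_diff_right)
  then have "convex D"
    unfolding D_def by (auto intro!: convex_Int convex_ball convex_halfspace_gt)
  have pi_in: "\<pi> y \<in> K - P \<and> norm (\<pi> y - p) < 2 * R" if "y \<in> D" for y
  proof -
    have "y \<notin> K" using n that by (force simp: D_def supports_def inner_commute)
    have piK: "\<pi> y \<in> K"
      unfolding \<pi>_def using closed_K \<open>K \<noteq> {}\<close> by (rule closest_point_in_set)
    have "y \<noteq> \<pi> y" using piK \<open>y \<notin> K\<close> by metis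
    have "(x - \<pi> y) \<bullet> (y - \<pi> y) \<le> 0" if "x \<in> K" for x
      unfolding \<pi>_def inner_commute[of "x - _"] using convex_K closed_K that by (rule closest_point_dot)
    then have "supports ((y - \<pi> y) /\<^sub>R norm (y - \<pi> y)) (\<pi> y)"
      using \<open>y \<noteq> \<pi> y\<close> by (auto simp: supports_def mult_le_0_iff)
    then have "\<pi> y \<notin> P" by (rule supporting_not_in_P) simp
    have "dist y (\<pi> y) \<le> dist y p"
      unfolding \<pi>_def using closed_K p by (intro closest_point_le) auto
    then have "dist p (\<pi> y) < 2 * R" using that dist_triangle[of p "\<pi> y" y]
      by (simp add: D_def dist_commute)
    then show ?thesis using piK \<open>\<pi> y \<notin> P\<close> by (simp add: dist_norm norm_minus_commute)
  qed
  \<comment> \<open>Cosine of the angle between the complex normal lines at \<open>\<pi> y\<close>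
    and at \<open>p\<close>.\<close>
  define G where "G y = cmod (herm (N (\<pi> y)) n)" for y
  have G_diff: "R * \<bar>G z - G y\<bar> \<le> \<bar>(\<pi> z - \<pi> y) \<bullet> N (\<pi> y)\<bar>" if "y \<in> D" "z \<in> D" for y z
  proof -
    have s: "supports (N (\<pi> y)) (\<pi> y)" "supports (N (\<pi> z)) (\<pi> z)"
      using N pi_in that by blast+
    then have nn: "norm (N (\<pi> y)) = 1" "norm (N (\<pi> z)) = 1" "norm n = 1"
      using n by (auto simp: supports_def)
    have "R * \<bar>G y - G z\<bar> \<le> R * norm (N (\<pi> y) - herm (N (\<pi> y)) (N (\<pi> z)) *s N (\<pi> z))"
      unfolding G_def using R nn by (intro mult_left_mono cmod_herm_diff_le) auto
    also have "\<dots> \<le> (\<pi> y - \<pi> z) \<bullet> N (\<pi> y)"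
    proof (rule normal_distance_le)
      show "\<pi> z + v \<in> K" if "herm v (N (\<pi> z)) = 0" "norm v \<le> R" for v
        using complex_tangent[OF _ _ s(2) that(1)] pi_in[OF \<open>z \<in> D\<close>] that(2) R
        by (simp add: dist_norm norm_minus_commute)
      show "(x - \<pi> y) \<bullet> N (\<pi> y) \<le> 0" if "x \<in> K" for x
        using s(1) that by (simp add: supports_def)
    qed (use R nn in auto)
    also have "\<dots> \<le> \<bar>(\<pi> z - \<pi> y) \<bullet> N (\<pi> y)\<bar>" by (simp add: inner_diff_left)
    finally show ?thesis by (simp add: abs_minus_commute)
  qed
  \<comment> \<open>\<open>G_diff\<close> bounds the change of \<open>G\<close> by a distance to the
    tangent hyperplane, which is of smaller order than the distance of the boundary points;
    nonexpansiveness of \<pi> carries this over to \<open>norm (z - y)\<close>.\<close>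
  have "(G has_derivative (\<lambda>h. 0)) (at y within D)" if "y \<in> D" for y
    unfolding has_derivative_within_alt
  proof (intro conjI allI impI)
    fix e :: real assume "e > 0"
    have piy: "\<pi> y \<in> K - P" "\<pi> y \<in> ball p (4 * R)"
      using pi_in[OF that] R by (auto simp: dist_norm norm_minus_commute)
    obtain d where d: "d > 0" "\<And>x. x \<in> K - P \<Longrightarrow> norm (x - \<pi> y) < d \<Longrightarrow>
        \<bar>(x - \<pi> y) \<bullet> N (\<pi> y)\<bar> \<le> (e * R) * norm (x - \<pi> y)"
      using supports_first_order[OF piy N[OF piy(1)], of "e * R"] \<open>e > 0\<close> R by auto
    have "norm (G z - G y - 0) \<le> e * norm (z - y)" if z: "z \<in> D" "norm (z - y) < d" for z
    proof -
      have lip: "norm (\<pi> z - \<pi> y) \<le> norm (z - y)"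
        using closest_point_lipschitz[OF convex_K closed_K \<open>K \<noteq> {}\<close>, of z y]
        by (simp add: \<pi>_def dist_norm)
      have "R * \<bar>G z - G y\<bar> \<le> (e * R) * norm (\<pi> z - \<pi> y)"
        using G_diff[OF \<open>y \<in> D\<close> z(1)] d(2)[of "\<pi> z"] pi_in[OF z(1)] lip z(2) by linarith
      also have "\<dots> \<le> (e * R) * norm (z - y)"
        using lip \<open>e > 0\<close> R by (simp add: mult_left_mono)
      finally show ?thesis using R by (simp add: mult.assoc mult.left_commute[of e])
    qed
    then show "\<exists>d>0. \<forall>z\<in>D. norm (z - y) < d \<longrightarrow> norm (G z - G y - 0) \<le> e * norm (z - y)"
      using d(1) by blast
  qed simp
  then obtain c where c: "\<And>y. y \<in> D \<Longrightarrow> G y = c"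
    using has_derivative_zero_constant[OF \<open>convex D\<close>, of G] by blast
  obtain r0 where r0: "r0 > 0"
    "\<And>q m. q \<in> K - P \<Longrightarrow> norm (q - p) < r0 \<Longrightarrow> supports m q \<Longrightarrow> 1 / 2 \<le> m \<bullet> n"
    using supports_near_p[OF n] by blast
  have nn: "norm n = 1" "n \<bullet> n = 1"
    using n by (simp_all add: supports_def flip: power2_norm_eq_inner)
  \<comment> \<open>The push by \<open>R / 2\<close> gains at least \<open>R / 4\<close> in the
    direction \<open>n\<close>, more than the less than \<open>R / 4\<close> that \<open>q\<close>
    may lie behind the hyperplane; so it ends in \<open>D\<close>.\<close>
  have near: "q + (R / 2) *\<^sub>R m \<in> D \<and> G (q + (R / 2) *\<^sub>R m) = cmod (herm m n)"
    if q: "q \<in> K - P" "norm (q - p) < min r0 (R / 4)" and m: "supports m q" for q m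
  proof
    have "norm (q + (R / 2) *\<^sub>R m - p) \<le> norm (q - p) + R / 2"
      using norm_triangle_ineq[of "q - p" "(R / 2) *\<^sub>R m"] m R
      by (simp add: supports_def algebra_simps)
    moreover have "norm (q - p) < R / 4" using q by simp
    ultimately have "norm (q + (R / 2) *\<^sub>R m - p) < R" using R by linarith
    moreover have "0 < n \<bullet> (q + (R / 2) *\<^sub>R m - p)"
    proof -
      have "\<bar>n \<bullet> (q - p)\<bar> \<le> norm (q - p)"
        using Cauchy_Schwarz_ineq2[of n "q - p"] nn by simp
      moreover have "R / 4 \<le> R / 2 * (n \<bullet> m)"
        using r0(2)[of q m] q m R by (simp add: inner_commute field_simps)
      moreover have "n \<bullet> (q + (R / 2) *\<^sub>R m - p) = n \<bullet> (q - p) + R / 2 * (n \<bullet> m)"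
        by (simp add: inner_diff_right inner_add_right)
      moreover have "norm (q - p) < R / 4" using q by simp
      ultimately show ?thesis by linarith
    qed
    ultimately show "q + (R / 2) *\<^sub>R m \<in> D" by (simp add: D_def dist_norm norm_minus_commute)
    have "\<pi> (q + (R / 2) *\<^sub>R m) = q"
      unfolding \<pi>_def using q m R by (intro closest_point_supports) auto
    moreover have "N q = m"
      using supports_unique[OF q(1) _ N[OF q(1)] m] q R by (simp add: dist_norm norm_minus_commute)
    ultimately show "G (q + (R / 2) *\<^sub>R m) = cmod (herm m n)" by (simp add: G_def)
  qed
  \<comment> \<open>The constant is read off at \<open>p\<close> itself, where the two normals
    coincide.\<close>
  have "c = 1"
    using near[OF p _ n] c[of "p + (R / 2) *\<^sub>R n"] r0(1) R nn by (simp add: herm_self)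
  show ?thesis
  proof (intro exI[of _ "min r0 (R / 4)"] conjI allI impI)
    show "0 < min r0 (R / 4)" using r0 R by simp
    fix q m assume "q \<in> K - P" "norm (q - p) < min r0 (R / 4)" "supports m q"
    from near[OF this] c \<open>c = 1\<close> show "cmod (herm m n) = 1" by metis
  qed
qed

text \<open>Modulus 1 is the equality case of Cauchy-Schwarz: the normal at \<open>q\<close> is a
  complex multiple of \<open>m\<close>, so both have the same complex orthogonal complement. The
  second assertion, that the gradient is not complex orthogonal to \<open>m\<close>, will make the
  planar curve regular.\<close>

lemma product_structure:
  "\<exists>m r. norm m = 1 \<and> 0 < r \<and> r \<le> R \<and>
    (\<forall>q v. q \<in> K - P \<longrightarrow> norm (q - p) < r \<longrightarrow> herm v m = 0 \<longrightarrow> norm v < 2 * R \<longrightarrow> q + v \<in> K - P) \<and>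
    (\<forall>q W \<rho> g. q \<in> K - P \<longrightarrow> norm (q - p) < r \<longrightarrow> q \<in> W \<longrightarrow> open W \<longrightarrow>
      (\<forall>x\<in>W. (\<rho> has_derivative (\<lambda>h. g x \<bullet> h)) (at x) \<and> g x \<noteq> 0) \<longrightarrow>
      (K - P) \<inter> W = {x\<in>W. \<rho> x = (0::real)} \<longrightarrow> herm (g q) m \<noteq> 0)"
proof -
  obtain m where m: "supports m p" using supports_exists[OF p] ..
  obtain r where r: "r > 0" "\<And>q n. q \<in> K - P \<Longrightarrow> norm (q - p) < r \<Longrightarrow> supports n q \<Longrightarrow> cmod (herm n m) = 1"
    using complex_normal_constant[OF m] by blast
  have nm: "norm m = 1" using m by (simp add: supports_def)
  show ?thesis
  proof (intro exI[of _ m] exI[of _ "min r R"] conjI allI impI)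
    fix q v assume q: "q \<in> K - P" "norm (q - p) < min r R" and v: "herm v m = 0" "norm v < 2 * R"
    obtain n where n: "supports n q" using supports_exists[OF q(1)] ..
    have "cmod (herm n m) = 1" using r(2)[OF q(1) _ n] q by simp
    then have "cmod (herm m n) = 1" by (metis complex_mod_cnj herm_cnj)
    then have "(norm (n - herm n m *s m))\<^sup>2 = 0"
      using n nm \<open>cmod (herm n m) = 1\<close> by (simp add: herm_distance_sq supports_def)
    then have nm': "n = herm n m *s m" by simp
    have "herm n v = 0"
      by (subst nm') (simp add: herm_scale v flip: herm_cnj[of v m])
    then have "herm v n = 0" by (metis complex_cnj_zero herm_cnj)
    then show "q + v \<in> K - P"
      using q n v R by (intro complex_tangent[where n = n]) (auto simp: dist_norm norm_minus_commute)
  next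
    fix q W \<rho> g assume q: "q \<in> K - P" "norm (q - p) < min r R" and W: "q \<in> W" "open W"
      "\<forall>x\<in>W. (\<rho> has_derivative (\<lambda>h. g x \<bullet> h)) (at x) \<and> g x \<noteq> 0"
      "(K - P) \<inter> W = {x\<in>W. \<rho> x = (0::real)}"
    obtain n where n: "supports n q" using supports_exists[OF q(1)] ..
    obtain c where "n = c *\<^sub>R g q" using supports_gradient[OF q(1) W(1) n W(2-4)] ..
    then have "n = of_real c *s g q" by (simp add: vec_eq_iff scaleR_conv_of_real[where 'a=complex])
    then have "herm n m = of_real c * herm (g q) m" by (simp add: herm_scale)
    moreover have "cmod (herm n m) = 1" using r(2)[OF q(1) _ n] q by simp
    ultimately show "herm (g q) m \<noteq> 0" by auto
  qed (use nm r R in auto)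
qed

end

section \<open>Product coordinates and the planar curve\<close>

text \<open>Slot \<open>k\<close> receives the functional, and slot \<open>j\<close> with
  \<open>m $ j \<noteq> 0\<close> takes over the displaced coordinate \<open>x $ k\<close>. A kernel
  vector then has only its \<open>j\<close>-th entry left, and the functional detects it. Testing
  \<open>i = k\<close> first also covers \<open>j = k\<close>.\<close>

lemma linear_bij_with_coordinate:
  fixes m :: "complex^'n" and k :: 'n
  assumes "m \<noteq> 0"
  obtains L :: "complex^'n \<Rightarrow> complex^'n"
  where "Vector_Spaces.linear (*s) (*s) L" "bij L" "\<And>x. L x $ k = herm x m"
proof -
  obtain j where j: "m $ j \<noteq> 0" using assms by (metis vec_eq_iff zero_index)
  define L :: "complex^'n \<Rightarrow> complex^'n"
    where "L x = (\<chi> i. if i = k then herm x m else if i = j then x $ k else x $ i)" for x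
  have lin: "Vector_Spaces.linear (*s) (*s) L"
    unfolding Vector_Spaces.linear_iff
    by (auto simp: L_def vec_eq_iff herm_add herm_scale vec.vector_space_axioms)
  have ker: "x = 0" if "L x = 0" for x
  proof -
    have L0: "(if i = k then herm x m else if i = j then x $ k else x $ i) = 0" for i
      using that by (simp add: L_def vec_eq_iff)
    have others: "x $ i = 0" if "i \<noteq> j" for i
      using L0[of i] L0[of j] that by (cases "i = k") auto
    have "herm x m = x $ j * cnj (m $ j)"
      unfolding herm_def using others by (subst sum.remove[of _ j]) auto
    then have "x $ j = 0" using L0[of k] j by simp
    then show ?thesis using others by (metis vec_eq_iff zero_index)
  qed
  have "inj L"
  proof (rule injI)
    fix x y assume "L x = L y"
    moreover have "L (x - y) = L x - L y"
      by (simp add: L_def vec_eq_iff herm_diff)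
    ultimately show "x = y" using ker[of "x - y"] by simp
  qed
  then have "bij L"
    using vec.linear_inj_imp_surj[OF lin] by (simp add: bij_def)
  then show ?thesis using that[OF lin] by (simp add: L_def)
qed

context convex_levi_flat
begin

text \<open>Within the ball, membership in \<open>K - P\<close> depends only on
  \<open>herm x m\<close>, so the image curve can be read off on a single complex line in direction
  \<open>m\<close>, where the defining functions of the hypersurface restrict to defining functions
  of the curve.\<close>

lemma linear_product_structure:
  "\<exists>m r. m \<noteq> 0 \<and> 0 < r \<and> r \<le> R \<and> planar_curve ((\<lambda>x. herm x m) ` ((K - P) \<inter> ball p r)) \<and>
     (\<forall>q\<in>(K - P) \<inter> ball p r. \<forall>x\<in>ball p r. herm x m = herm q m \<longrightarrow> x \<in> K - P)"
proof -
  obtain m r where nm: "norm m = 1" and r: "0 < r" "r \<le> R"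
    and prod: "\<And>q v. q \<in> K - P \<Longrightarrow> norm (q - p) < r \<Longrightarrow> herm v m = 0 \<Longrightarrow> norm v < 2 * R \<Longrightarrow> q + v \<in> K - P"
    and grad: "\<And>q W \<rho> g. q \<in> K - P \<Longrightarrow> norm (q - p) < r \<Longrightarrow> q \<in> W \<Longrightarrow> open W \<Longrightarrow>
      \<forall>x\<in>W. (\<rho> has_derivative (\<lambda>h. g x \<bullet> h)) (at x) \<and> g x \<noteq> 0 \<Longrightarrow>
      (K - P) \<inter> W = {x\<in>W. \<rho> x = (0::real)} \<Longrightarrow> herm (g q) m \<noteq> 0"
    using product_structure by blast
  have same: "x \<in> K - P" if "q \<in> K - P" "q \<in> ball p r" "x \<in> ball p r" "herm x m = herm q m" for x q
  proof -
    have "dist q x < 2 * R"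
      using dist_triangle[of q x p] that r by (simp add: dist_commute)
    then show ?thesis
      using prod[of q "x - q"] that by (simp add: herm_diff dist_norm norm_minus_commute)
  qed
  \<comment> \<open>An isometric section of \<open>x \<mapsto> herm x m\<close> through
    \<open>p\<close>; it maps the disc of radius \<open>r\<close> into the ball.\<close>
  define \<phi> where "\<phi> c = p + (c - herm p m) *s m" for c
  have herm_phi: "herm (\<phi> c) m = c" for c
    unfolding \<phi>_def herm_add herm_scale by (simp add: herm_self nm)
  have phi_dist: "dist p (\<phi> c) = dist (herm p m) c" for c
    using norm_scaleC[of "c - herm p m" m] unfolding \<phi>_def
    by (simp add: dist_norm nm norm_minus_commute del: vector_ssub_ldistrib vector_sub_rdistrib)
  define \<gamma> where "\<gamma> = (\<lambda>x. herm x m) ` ((K - P) \<inter> ball p r)"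
  have gamma_iff: "c \<in> \<gamma> \<longleftrightarrow> dist (herm p m) c < r \<and> \<phi> c \<in> K - P" for c
  proof
    assume "c \<in> \<gamma>"
    then obtain x where x: "x \<in> K - P" "x \<in> ball p r" "c = herm x m" by (auto simp: \<gamma>_def)
    have "dist (herm p m) c \<le> dist p x"
      using norm_herm_le[of "p - x" m] by (simp add: x dist_norm herm_diff nm)
    then have "dist (herm p m) c < r" using x by simp
    moreover then have "\<phi> c \<in> ball p r" by (simp add: phi_dist)
    then have "\<phi> c \<in> K - P" using same[OF x(1,2)] x(3) herm_phi by blast
    ultimately show "dist (herm p m) c < r \<and> \<phi> c \<in> K - P" by blast
  next
    assume "dist (herm p m) c < r \<and> \<phi> c \<in> K - P"
    then have "\<phi> c \<in> (K - P) \<inter> ball p r" by (simp add: phi_dist)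
    then show "c \<in> \<gamma>" unfolding \<gamma>_def by (metis herm_phi imageI)
  qed
  have cont_phi: "continuous_on S \<phi>" for S unfolding \<phi>_def by (intro continuous_intros)
  have "planar_curve \<gamma>"
    unfolding planar_curve_def C1_hypersurface_def
  proof
    fix c assume "c \<in> \<gamma>"
    then have c: "dist (herm p m) c < r" "\<phi> c \<in> K - P" by (auto simp: gamma_iff)
    then have near: "\<phi> c \<in> ball p (4 * R)" "norm (\<phi> c - p) < r"
      using r phi_dist[of c] by (auto simp: dist_commute simp flip: dist_norm)
    obtain W \<rho> g where W: "open W" "\<phi> c \<in> W" "continuous_on W g"
      "\<forall>x\<in>W. (\<rho> has_derivative (\<lambda>h. g x \<bullet> h)) (at x) \<and> g x \<noteq> 0"
      "(K - P) \<inter> W = {x\<in>W. \<rho> x = (0::real)}"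
      using C1[OF c(2) near(1)] by blast
    define W1 where "W1 = ball (herm p m) r \<inter> \<phi> -` W"
    have "open W1"
      unfolding W1_def using W(1) cont_phi by (intro open_Int open_ball open_vimage)
    define g' where "g' c = herm (g (\<phi> c)) m" for c
    have "continuous_on W1 (\<lambda>c. g (\<phi> c))"
      by (rule continuous_on_compose2[OF W(3) cont_phi]) (auto simp: W1_def)
    then have cg': "continuous_on W1 g'"
      unfolding g'_def herm_def by (intro continuous_intros)
    \<comment> \<open>\<open>grad\<close> speaks only of points of \<open>K - P\<close>, whereas the
      gradient must be nonzero on a full neighbourhood; continuity of \<open>g'\<close> permits the
      shrinking.\<close>
    define W2 where "W2 = W1 \<inter> g' -` (- {0})"
    have "open W2"
      unfolding W2_def using cg' \<open>open W1\<close> by (intro continuous_open_preimage) auto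
    have "c \<in> W2"
      using grad[OF c(2) near(2) W(2,1,4,5)] c W(2) by (simp add: W2_def W1_def g'_def)
    moreover have "((\<lambda>c. \<rho> (\<phi> c)) has_derivative (\<lambda>h. g' x \<bullet> h)) (at x) \<and> g' x \<noteq> 0" if "x \<in> W2" for x
    proof
      show "g' x \<noteq> 0" using that by (simp add: W2_def)
      have "bounded_linear (\<lambda>h::complex. h *s m)"
        by (rule linear_conv_bounded_linear[THEN iffD1])
           (auto intro!: linearI simp: vector_sadd_rdistrib vec_eq_iff algebra_simps)
      then have "((\<lambda>c. (c - herm p m) *s m) has_derivative (\<lambda>h. h *s m)) (at x)"
        by (rule bounded_linear.has_derivative) (auto intro!: derivative_eq_intros)
      from has_derivative_add[OF has_derivative_const[of p] this]
      have "(\<phi> has_derivative (\<lambda>h. h *s m)) (at x)"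
        unfolding \<phi>_def by simp
      moreover have "(\<rho> has_derivative (\<lambda>h. g (\<phi> x) \<bullet> h)) (at (\<phi> x))"
        using W(4) that by (simp add: W2_def W1_def)
      ultimately have "((\<lambda>c. \<rho> (\<phi> c)) has_derivative (\<lambda>h. g (\<phi> x) \<bullet> (h *s m))) (at x)"
        by (rule has_derivative_compose)
      also have "(\<lambda>h. g (\<phi> x) \<bullet> (h *s m)) = (\<lambda>h. g' x \<bullet> h)"
      proof
        fix h
        have "g (\<phi> x) \<bullet> (h *s m) = Re (h * cnj (g' x))"
          by (simp add: inner_commute[of "g (\<phi> x)"] scaleC_inner g'_def herm_cnj)
        then show "g (\<phi> x) \<bullet> (h *s m) = g' x \<bullet> h"
          by (simp add: inner_complex_def algebra_simps)
      qed
      finally show "((\<lambda>c. \<rho> (\<phi> c)) has_derivative (\<lambda>h. g' x \<bullet> h)) (at x)" .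
    qed
    moreover have "\<gamma> \<inter> W2 = {x \<in> W2. \<rho> (\<phi> x) = 0}"
    proof -
      have "y \<in> K - P \<longleftrightarrow> \<rho> y = 0" if "y \<in> W" for y using W(5) that by blast
      then show ?thesis unfolding set_eq_iff Int_iff mem_Collect_eq gamma_iff
        by (simp add: W2_def W1_def) blast
    qed
    moreover have "continuous_on W2 g'" using cg' by (rule continuous_on_subset) (simp add: W2_def)
    ultimately show "\<exists>W \<rho> g. open W \<and> c \<in> W \<and> continuous_on W g \<and>
        (\<forall>x\<in>W. (\<rho> has_derivative (\<lambda>h. g x \<bullet> h)) (at x) \<and> g x \<noteq> 0) \<and>
        \<gamma> \<inter> W = {x\<in>W. \<rho> x = (0::real)}"
      using \<open>open W2\<close>
      by (intro exI[of _ W2] exI[of _ "\<lambda>c. \<rho> (\<phi> c)"] exI[of _ g']) blast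
  qed
  moreover have "m \<noteq> 0" using nm by auto
  ultimately show ?thesis
    using r same unfolding \<gamma>_def
    by (intro exI[of _ m] exI[of _ r] conjI ballI impI) (assumption | erule IntE)+
qed

end

section \<open>Application to the two sides of the hypersurface\<close>

theorem proposition1:
  fixes M U Mplus Mminus :: "(complex^'n) set" and p :: "complex^'n" and k :: 'n
  assumes "p \<in> M"
    and "C1_smooth_point M p"
    and "divides_near M p U Mplus Mminus"
    and "convex Mplus"
  shows "\<exists>V L \<gamma>. open V \<and> p \<in> V \<and>
           Vector_Spaces.linear (*s) (*s) L \<and> bij L \<and>
           planar_curve \<gamma> \<and>
           L ` (M \<inter> V) = curve_times_Cn1 k \<gamma> \<inter> L ` V"
proof -
  have U: "open U" "p \<in> U" and hyp: "C1_hypersurface (M \<inter> U)"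
    and part: "U - M = Mplus \<union> Mminus" "Mplus \<inter> Mminus = {}"
    and pc: "pseudoconvex_domain Mplus" "pseudoconvex_domain Mminus"
    and front: "M \<inter> U = frontier Mplus \<inter> U"
    using assms(3) unfolding divides_near_def by blast+
  define K where "K = closure Mplus"
  have op: "open Mplus" "Mplus \<noteq> {}" using pc by (auto simp: pseudoconvex_domain_def)
  have "frontier Mplus = K - Mplus" using op by (simp add: frontier_def interior_open K_def)
  then have M: "M \<inter> U = (K - Mplus) \<inter> U" using front by simp
  \<comment> \<open>Inside \<open>U\<close> the closure of \<open>Mplus\<close> consists of points
    of \<open>Mplus\<close> and of \<open>M\<close>, and \<open>Mminus\<close> lies in
    \<open>U\<close> and avoids both.\<close>
  have disj: "Mminus \<inter> K = {}" using M part by blast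
  obtain e where e: "e > 0" "ball p e \<subseteq> U" using U open_contains_ball by blast
  interpret convex_levi_flat K Mplus Mminus p "e / 4"
  proof
    show "ball p (4 * (e / 4)) - K \<subseteq> Mminus"
    proof
      fix x assume "x \<in> ball p (4 * (e / 4)) - K"
      then have "x \<in> U" "x \<notin> K" using e by auto
      moreover have "Mplus \<subseteq> K" by (simp add: K_def closure_subset)
      ultimately show "x \<in> Mminus" using M part by blast
    qed
    show "p \<in> K - Mplus" using M assms(1) U by blast
    fix q assume q: "q \<in> K - Mplus" "q \<in> ball p (4 * (e / 4))"
    then have "q \<in> M \<inter> U" using M e by auto
    with hyp have "\<exists>W \<rho> g. open W \<and> q \<in> W \<and> continuous_on W g \<and>
        (\<forall>x\<in>W. (\<rho> has_derivative (\<lambda>h. g x \<bullet> h)) (at x) \<and> g x \<noteq> 0) \<and>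
        M \<inter> U \<inter> W = {x\<in>W. \<rho> x = (0::real)}"
      unfolding C1_hypersurface_def by (rule bspec)
    then obtain W \<rho> g where W: "open W" "q \<in> W" "continuous_on W g"
      "\<forall>x\<in>W. (\<rho> has_derivative (\<lambda>h. g x \<bullet> h)) (at x) \<and> g x \<noteq> 0"
      "M \<inter> U \<inter> W = {x\<in>W. \<rho> x = (0::real)}"
      by blast
    \<comment> \<open>The boundary of \<open>Mplus\<close> is known to agree with \<open>M\<close>
      only in \<open>U\<close>, so the chart is cut down to \<open>U\<close>.\<close>
    have "(K - Mplus) \<inter> (W \<inter> U) = {x\<in>W \<inter> U. \<rho> x = 0}" using W(5) M by blast
    then show "\<exists>W \<rho> g. open W \<and> q \<in> W \<and> continuous_on W g \<and>
        (\<forall>x\<in>W. (\<rho> has_derivative (\<lambda>h. g x \<bullet> h)) (at x) \<and> g x \<noteq> 0) \<and>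
        (K - Mplus) \<inter> W = {x\<in>W. \<rho> x = (0::real)}"
      using W U(1) \<open>q \<in> M \<inter> U\<close> continuous_on_subset[OF W(3), of "W \<inter> U"]
      by (intro exI[of _ "W \<inter> U"] exI[of _ \<rho>] exI[of _ g]) auto
  qed (use pc disj op assms(4) e in \<open>simp_all add: K_def\<close>)
  obtain m r where m: "m \<noteq> 0" and r: "0 < r" "r \<le> e / 4"
    and curve: "planar_curve ((\<lambda>x. herm x m) ` ((K - Mplus) \<inter> ball p r))"
    and same: "\<And>q x. q \<in> (K - Mplus) \<inter> ball p r \<Longrightarrow> x \<in> ball p r \<Longrightarrow> herm x m = herm q m \<Longrightarrow> x \<in> K - Mplus"
    using linear_product_structure by blast
  obtain L :: "complex^'n \<Rightarrow> complex^'n" where L: "Vector_Spaces.linear (*s) (*s) L" "bij L"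
    "\<And>x. L x $ k = herm x m"
    using linear_bij_with_coordinate[OF m] by blast
  have "ball p r \<subseteq> U" using e r by auto
  then have MV: "M \<inter> ball p r = (K - Mplus) \<inter> ball p r" using M by blast
  have "L ` (M \<inter> ball p r) =
      curve_times_Cn1 k ((\<lambda>x. herm x m) ` ((K - Mplus) \<inter> ball p r)) \<inter> L ` ball p r" (is "?l = ?r")
  proof
    show "?l \<subseteq> ?r" unfolding MV by (auto simp: curve_times_Cn1_def L(3))
    show "?r \<subseteq> ?l"
    proof
      fix z assume "z \<in> ?r"
      then obtain x q where "z = L x" "x \<in> ball p r" "q \<in> (K - Mplus) \<inter> ball p r" "herm x m = herm q m"
        by (auto simp: curve_times_Cn1_def L(3))
      then show "z \<in> ?l" unfolding MV using same by blast
    qed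
  qed
  then show ?thesis
    using L(1,2) curve r(1)
    by (intro exI[of _ "ball p r"] exI[of _ L] exI[of _ "(\<lambda>x. herm x m) ` ((K - Mplus) \<inter> ball p r)"]) auto
qed

end
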